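(* Let $P$ be an alcoved polytope with alcoved triangulation $\Delta$ and fix a simplex $F_0$ in $\Delta$. Let $G_\Delta$ be the dual graph of $\Delta$ and $D_\Delta(F_0)$ its orientation away from $F_0$. Then for every $k$, $$h_k^*(P)=\#\{F\in\Delta:\ F\text{ has exactly }k\text{ incoming arcs in }D_\Delta(F_0)\}.$$
   Context: For $l\in\mathbb{Z}$, $i,j\in\{0,\dots,n\}$ let $H_{i,j}^l=\{x\in\mathbb{R}^n:x_i-x_j=l\}$ with $x_0=0$; $\mathcal{A}_n$ is the arrangement of all such hyperplanes. A polytope $P$ is alcoved if all its facet-defining hyperplanes are of the form $H_{i,j}^l$ (so $P$ is a lattice polytope); $\mathcal{A}_n$ induces a triangulation $\Delta$ of $P$ into unimodular simplices, the alcoved triangulation. The dual graph $G_\Delta$ has vertex set $\Delta$ and an edge between two simplices whenever their intersection is a facet of both; $d$ denotes graph distance in $G_\Delta$. The orientation away from $F_0$, $D_\Delta(F_0)$, orients the edge between adjacent $F,F'$ as $F\to F'$ iff $d(F_0,F')=d(F_0,F)+1$ (and leaves it unoriented otherwise). For a lattice polytope $P$ of dimension $d$, with $L_P(t)=\#(tP\cap\mathbb{Z}^n)$, one writes $\sum_{t\ge0}L_P(t)z^t=\frac{h_0^*+h_1^*z+\dots+h_m^*z^m}{(1-z)^{d+1}}$; $(h_0^*,\dots,h_m^* )$ is the $h^*$-vector of $P$ (and $h^*_k=0$ for $k>m$). *)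

theory Defs
  imports
    "HOL-Analysis.Analysis"
    "HOL-Computational_Algebra.Formal_Power_Series"
begin

text \<open>The index set \<open>{0,...,n}\<close> is \<^typ>\<open>'n option\<close>, with \<^const>\<open>None\<close> in the role of \<open>0\<close>.\<close>

definition ext_coord :: "real ^ 'n \<Rightarrow> 'n option \<Rightarrow> real" where
  "ext_coord x i = (case i of None \<Rightarrow> 0 | Some m \<Rightarrow> x $ m)"

definition alcove_hyperplane :: "'n option \<Rightarrow> 'n option \<Rightarrow> int \<Rightarrow> (real ^ 'n) set" where
  "alcove_hyperplane i j l = {x. ext_coord x i - ext_coord x j = of_int l}"

text \<open>For \<open>i = j\<close> the defining equation does not describe a hyperplane.\<close>

definition alcove_arrangement :: "(real ^ 'n) set set" where
  "alcove_arrangement = {alcove_hyperplane i j l | i j l. i \<noteq> j}"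

definition facet_defining :: "'a::euclidean_space set \<Rightarrow> 'a set \<Rightarrow> bool" where
  "facet_defining P H \<longleftrightarrow>
     (\<exists>a b. a \<noteq> 0 \<and> H = {x. a \<bullet> x = b} \<and> P \<subseteq> {x. a \<bullet> x \<le> b} \<and> (P \<inter> H) facet_of P)"

text \<open>A facet of a polytope that is not full-dimensional is cut out by many hyperplanes, and only
  their traces on the affine hull are determined by the facet.  So facet-defining hyperplanes are
  compared inside the affine hull, and the affine hull itself has to be cut out by hyperplanes of
  the arrangement (without this, the segment from \<open>(0,0)\<close> to \<open>(1,2)\<close> would qualify, and so would
  every point).  For full-dimensional polytopes both provisos are void, see \<open>alcoved_full_dim\<close>.\<close>

definition alcoved :: "(real ^ 'n) set \<Rightarrow> bool" where
  "alcoved P \<longleftrightarrow> polytope P \<and>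
     (\<exists>\<H> \<subseteq> alcove_arrangement. affine hull P = \<Inter>\<H>) \<and>
     (\<forall>H. facet_defining P H \<longrightarrow>
        (\<exists>H' \<in> alcove_arrangement. affine hull P \<inter> H = affine hull P \<inter> H'))"

lemma alcoved_full_dim:
  fixes P :: "(real ^ 'n) set"
  assumes "aff_dim P = int CARD('n)"
  shows "alcoved P \<longleftrightarrow>
    polytope P \<and> (\<forall>H. facet_defining P H \<longrightarrow> H \<in> alcove_arrangement)"
proof -
  have hull: "affine hull P = UNIV"
    using assms aff_dim_eq_full[of P] by simp
  have "\<exists>\<H> \<subseteq> alcove_arrangement. (UNIV :: (real ^ 'n) set) = \<Inter>\<H>"
    by (rule exI[of _ "{}"]) simp
  then show ?thesis
    unfolding alcoved_def hull by auto
qed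

text \<open>The maximal simplices of the triangulation: closures of the regions into which the
  hyperplanes of the arrangement that do not contain \<open>P\<close> dissect \<open>P\<close>.\<close>

definition alcoved_triangulation :: "(real ^ 'n) set \<Rightarrow> (real ^ 'n) set set" where
  "alcoved_triangulation P =
     closure ` components (P - \<Union>{H \<in> alcove_arrangement. \<not> P \<subseteq> H})"

definition dual_graph :: "'a::euclidean_space set set \<Rightarrow> ('a set \<times> 'a set) set" where
  "dual_graph \<Delta> =
     {(F, F'). F \<in> \<Delta> \<and> F' \<in> \<Delta> \<and> (F \<inter> F') facet_of F \<and> (F \<inter> F') facet_of F'}"

definition graph_dist :: "('v \<times> 'v) set \<Rightarrow> 'v \<Rightarrow> 'v \<Rightarrow> nat" where
  "graph_dist E u v = (LEAST m. (u, v) \<in> E ^^ m)"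

definition orientation_away :: "('v \<times> 'v) set \<Rightarrow> 'v \<Rightarrow> ('v \<times> 'v) set" where
  "orientation_away E u = {(v, w) \<in> E. graph_dist E u w = graph_dist E u v + 1}"

definition incoming_arcs :: "('v \<times> 'v) set \<Rightarrow> 'v \<Rightarrow> ('v \<times> 'v) set" where
  "incoming_arcs D w = {a \<in> D. snd a = w}"

definition ehrhart_count :: "(real ^ 'n) set \<Rightarrow> nat \<Rightarrow> nat" where
  "ehrhart_count P t = card ((\<lambda>x. real t *\<^sub>R x) ` P \<inter> {x. \<forall>i. x $ i \<in> \<int>})"

definition ehrhart_series :: "(real ^ 'n) set \<Rightarrow> int fps" where
  "ehrhart_series P = Abs_fps (\<lambda>t. int (ehrhart_count P t))"

text \<open>The numerator of the Ehrhart series over the denominator \<open>(1 - z)^(d+1)\<close>.\<close>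

definition h_star :: "(real ^ 'n) set \<Rightarrow> nat \<Rightarrow> int" where
  "h_star P k = fps_nth (ehrhart_series P * (1 - fps_X) ^ (nat (aff_dim P) + 1)) k"

end

theory Submission
  imports Defs
begin

text \<open>
  An alcoved polytope is cut out by inequalities \<open>x\<^sub>i - x\<^sub>j \<le> l\<close> with integral \<open>l\<close>, so an alcove
  that meets it in a point off the hyperplanes lies entirely inside.  Fix a generic point \<open>q\<close> of
  \<open>F\<^sub>0\<close> and remove from every simplex \<open>F\<close> the facets whose hyperplane separates \<open>F\<close> from \<open>q\<close>.  Since
  a point \<open>y\<close> of \<open>P\<close> belongs to the half-open \<open>F\<close> exactly if \<open>y + \<epsilon> (q - y)\<close> lies in the interior of
  \<open>F\<close> for all small \<open>\<epsilon> > 0\<close>, these half-open simplices partition \<open>P\<close>.  Unimodularity gives a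
  half-open simplex with \<open>k\<close> facets removed the Ehrhart series \<open>z^k / (1 - z)^(d + 1)\<close>.  Finally, a
  facet of \<open>F\<close> is removed iff it carries an incoming arc, because the distance from \<open>F\<^sub>0\<close> in the dual
  graph is the number of separating hyperplanes.
\<close>

section \<open>Integral half-spaces\<close>

text \<open>The combinatorial data are the integers \<open>\<lfloor>cdiff x i j\<rfloor>\<close>.
  They determine the simplex around a generic point; adjacent simplices differ in them for one pair
  and its reverse, by one; the total difference over all pairs is twice the graph distance.
  Unimodularity comes from a circle: modulo 1, the coordinates of a generic point cut a circle of
  length 1 into arcs, and barycentric coordinates are arc lengths. Conversely, coordinates are
  integers plus partial sums of arc lengths, so the two kinds of coordinates have the same
  denominators. The facets belong to cyclically consecutive pairs. Two obstacles shape the set-up.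
  \<open>P\<close> may have lower dimension, so that hyperplanes of the arrangement can contain it;
  such pairs of indices are tied, and one index is kept from each class, which leaves one more index
  than the dimension. And a facet-defining hyperplane agrees with one of the arrangement only as a
  set and only inside the affine hull, so the valid integral inequality and its direction have to be
  recovered.\<close>

definition cdiff :: "real ^ 'n \<Rightarrow> 'n option \<Rightarrow> 'n option \<Rightarrow> real" where
  "cdiff x i j = ext_coord x i - ext_coord x j"

definition ext_axis :: "'n option \<Rightarrow> real ^ 'n" where
  "ext_axis i = (case i of None \<Rightarrow> 0 | Some m \<Rightarrow> axis m 1)"

lemma ext_coord_None [simp]: "ext_coord x None = 0"
  by (simp add: ext_coord_def)

lemma ext_coord_Some [simp]: "ext_coord x (Some m) = x $ m"
  by (simp add: ext_coord_def)

lemma cdiff_inner: "cdiff x i j = (ext_axis i - ext_axis j) \<bullet> x"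
  by (cases i; cases j) (simp_all add: cdiff_def ext_axis_def inner_diff_left inner_axis')

lemma cdiff_self [simp]: "cdiff x i i = 0"
  by (simp add: cdiff_def)

lemma cdiff_swap: "cdiff x j i = - cdiff x i j"
  by (simp add: cdiff_def)

lemma cdiff_add: "cdiff x i j + cdiff x j k = cdiff x i k"
  by (simp add: cdiff_def)

lemma cdiff_None [simp]: "cdiff x i None = ext_coord x i"
  by (simp add: cdiff_def)

lemma cdiff_toward:
  "cdiff (x + e *\<^sub>R (y - x)) i j = cdiff x i j + e * (cdiff y i j - cdiff x i j)"
  by (simp add: cdiff_inner inner_add_right inner_diff_right)

lemma continuous_on_cdiff [continuous_intros]: "continuous_on S (\<lambda>x. cdiff x i j)"
  unfolding cdiff_inner by (intro continuous_intros)

lemma alcove_hyperplane_cdiff: "alcove_hyperplane i j l = {x. cdiff x i j = of_int l}"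
  by (simp add: alcove_hyperplane_def cdiff_def)

lemma toward_in_convex:
  assumes "convex S" "x \<in> S" "y \<in> S" "0 \<le> e" "e \<le> 1"
  shows "x + e *\<^sub>R (y - x) \<in> S"
  using convexD_alt[OF assms] by (simp add: algebra_simps)

lemma ex_crossing:
  fixes u v b :: real
  assumes "u < b" "b < v"
  obtains e where "0 < e" "e < 1" "u + e * (v - u) = b"
proof
  show "0 < (b - u) / (v - u)" "(b - u) / (v - u) < 1" "u + (b - u) / (v - u) * (v - u) = b"
    using assms by (auto simp: field_simps)
qed

lemma inner_toward:
  fixes a x y :: "'a::real_inner"
  shows "a \<bullet> (x + e *\<^sub>R (y - x)) = a \<bullet> x + e * (a \<bullet> y - a \<bullet> x)"
  by (simp add: inner_add_right inner_diff_right)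

text \<open>If \<open>y\<close> violated the facet inequality, a segment from \<open>P\<close> to
  \<open>y\<close> would cross the facet hyperplane, which on the affine hull is an integral
  hyperplane. Since \<open>P\<close> lies on one side of the latter, that side is a valid integral
  inequality, and \<open>y\<close> violates it too.\<close>

lemma alcoved_facet_halfspace:
  fixes P :: "(real ^ 'n) set"
  assumes "alcoved P" and facet: "(P \<inter> {x. a \<bullet> x = b}) facet_of P"
    and a: "a \<noteq> 0" and le: "P \<subseteq> {x. a \<bullet> x \<le> b}"
    and y: "y \<in> affine hull P"
    and valid: "\<And>i j l. (\<And>x. x \<in> P \<Longrightarrow> cdiff x i j \<le> of_int l) \<Longrightarrow> cdiff y i j \<le> of_int l"
  shows "a \<bullet> y \<le> b"
proof (rule ccontr)
  assume "\<not> a \<bullet> y \<le> b"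
  then have yb: "b < a \<bullet> y" by simp
  have cv: "convex P"
    using assms(1) polytope_imp_convex by (auto simp: alcoved_def)
  have "facet_defining P {x. a \<bullet> x = b}"
    unfolding facet_defining_def using a le facet by blast
  then obtain H' where H': "H' \<in> alcove_arrangement"
      "affine hull P \<inter> {x. a \<bullet> x = b} = affine hull P \<inter> H'"
    using assms(1) by (auto simp: alcoved_def)
  then obtain i j l where "H' = alcove_hyperplane i j l"
    by (auto simp: alcove_arrangement_def)
  with H'(2) have H: "a \<bullet> x = b \<longleftrightarrow> cdiff x i j = of_int l" if "x \<in> affine hull P" for x
    using that by (auto simp: alcove_hyperplane_cdiff set_eq_iff)
  have hullP: "x \<in> affine hull P" if "x \<in> P" for x
    using that by (rule hull_inc)
  have aff: "x + e *\<^sub>R (z - x) \<in> affine hull P"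
    if "x \<in> affine hull P" "z \<in> affine hull P" for x z e
    using mem_affine[OF affine_affine_hull that, of "1 - e" e] by (simp add: algebra_simps)
  have "\<not> P \<subseteq> {x. a \<bullet> x = b}"
  proof
    assume "P \<subseteq> {x. a \<bullet> x = b}"
    then have "P \<inter> {x. a \<bullet> x = b} = P" by blast
    with facet show False by simp
  qed
  with le obtain p where p: "p \<in> P" "a \<bullet> p < b"
    by fastforce
  obtain e where e: "0 < e" "e < 1" "a \<bullet> p + e * (a \<bullet> y - a \<bullet> p) = b"
    using ex_crossing[OF p(2) yb] by blast
  then have "cdiff (p + e *\<^sub>R (y - p)) i j = of_int l"
    using H[OF aff[OF hullP[OF p(1)] y], of e] by (simp add: inner_toward)
  \<comment> \<open>Both weights are positive, so \<open>p\<close> and \<open>y\<close> lie strictly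
    on opposite sides of the integral hyperplane once neither lies on it.\<close>
  then have mid: "(1 - e) * (cdiff p i j - l) + e * (cdiff y i j - l) = 0"
    unfolding cdiff_toward by (simp add: algebra_simps)
  have pl: "cdiff p i j \<noteq> l" and yl: "cdiff y i j \<noteq> l"
    using H[OF hullP[OF p(1)]] H[OF y] p yb by auto
  \<comment> \<open>The crossing point of such a segment attains the maximum \<open>b\<close> of
    \<open>a\<close> over \<open>P\<close> strictly between its ends, so the ends would attain it as
    well.\<close>
  have one_side: False if p12: "p1 \<in> P" "p2 \<in> P" "cdiff p1 i j < l" "l < cdiff p2 i j" for p1 p2
  proof -
    obtain e where e: "0 < e" "e < 1" "cdiff p1 i j + e * (cdiff p2 i j - cdiff p1 i j) = l"
      using ex_crossing[OF p12(3,4)] by blast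
    then have "a \<bullet> (p1 + e *\<^sub>R (p2 - p1)) = b"
      using H[OF aff[OF hullP[OF p12(1)] hullP[OF p12(2)]], of e] by (simp add: cdiff_toward)
    then have "(1 - e) * (b - a \<bullet> p1) + e * (b - a \<bullet> p2) = 0"
      by (simp add: inner_toward algebra_simps)
    moreover have "0 \<le> (1 - e) * (b - a \<bullet> p1)" "0 \<le> e * (b - a \<bullet> p2)"
      using e le p12 by (auto intro!: mult_nonneg_nonneg)
    ultimately have "(1 - e) * (b - a \<bullet> p1) = 0" by linarith
    with e have "a \<bullet> p1 = b" by simp
    with H[OF hullP[OF p12(1)]] p12(3) show False by simp
  qed
  show False
  proof (cases "cdiff p i j < l")
    case True
    then have "cdiff y i j \<le> l"
      using one_side p(1) by (intro valid) (meson not_le)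
    with yl e(1,2) True have "(1 - e) * (cdiff p i j - l) < 0" "e * (cdiff y i j - l) < 0"
      by (auto simp: mult_less_0_iff)
    with mid show False by linarith
  next
    case False
    with pl have *: "l < cdiff p i j" by simp
    then have "cdiff x j i \<le> of_int (- l)" if "x \<in> P" for x
      using one_side[OF that p(1)] by (force simp: cdiff_swap[of _ j i] not_le[symmetric])
    then have "cdiff y j i \<le> of_int (- l)"
      by (intro valid)
    with yl have "cdiff y i j > l" by (simp add: cdiff_swap[of _ j i])
    with e * have "(1 - e) * (cdiff p i j - l) > 0" "e * (cdiff y i j - l) > 0"
      by auto
    with mid show False by linarith
  qed
qed

text \<open>The affine hull is cut out by equations of the arrangement, each of which is a pair of
  opposite integral inequalities; inside it, an irredundant description of \<open>P\<close> uses
  facet inequalities only.\<close>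

lemma alcoved_halfspaces:
  fixes P :: "(real ^ 'n) set"
  assumes "alcoved P"
    and valid: "\<And>i j l. (\<And>x. x \<in> P \<Longrightarrow> cdiff x i j \<le> of_int l) \<Longrightarrow> cdiff y i j \<le> of_int l"
  shows "y \<in> P"
proof -
  obtain \<H> where \<H>: "\<H> \<subseteq> alcove_arrangement" "affine hull P = \<Inter>\<H>"
    using assms(1) by (auto simp: alcoved_def)
  have "y \<in> H" if H\<H>: "H \<in> \<H>" for H
  proof -
    obtain i j l where H: "H = alcove_hyperplane i j l"
      using \<H>(1) H\<H> unfolding alcove_arrangement_def by blast
    have "P \<subseteq> H"
      using \<H>(2) that hull_subset[of P affine] by blast
    then have *: "cdiff x i j = l" if "x \<in> P" for x
      using that by (auto simp: H alcove_hyperplane_cdiff)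
    have "cdiff y i j \<le> l" "cdiff y j i \<le> of_int (- l)"
      by (rule valid; simp add: * cdiff_swap[of _ j i])+
    then show ?thesis
      by (simp add: H alcove_hyperplane_cdiff cdiff_swap[of _ j i])
  qed
  then have yA: "y \<in> affine hull P"
    using \<H>(2) by blast
  have "polyhedron P"
    using assms(1) polytope_imp_polyhedron by (auto simp: alcoved_def)
  then obtain \<F> where \<F>: "finite \<F>" "P = affine hull P \<inter> \<Inter>\<F>"
      "\<forall>h\<in>\<F>. \<exists>a b. a \<noteq> 0 \<and> h = {x. a \<bullet> x \<le> b}"
      "\<forall>F'. F' \<subset> \<F> \<longrightarrow> P \<subset> affine hull P \<inter> \<Inter>F'"
    unfolding polyhedron_Int_affine_minimal by blast
  then obtain a b where ab: "\<And>h. h \<in> \<F> \<Longrightarrow> a h \<noteq> 0 \<and> h = {x. a h \<bullet> x \<le> b h}"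
    by metis
  have "y \<in> h" if h: "h \<in> \<F>" for h
  proof -
    have fac: "(P \<inter> {x. a h \<bullet> x = b h}) facet_of P"
      using facet_of_polyhedron_explicit[of \<F> P a b, OF \<F>(1,2) ab] \<F>(4) h by blast
    have le: "P \<subseteq> {x. a h \<bullet> x \<le> b h}"
      using \<F>(2) ab[OF h] h by blast
    have "a h \<bullet> y \<le> b h"
      using alcoved_facet_halfspace[OF assms(1) fac _ le yA] ab[OF h] valid by blast
    with ab[OF h] show ?thesis by blast
  qed
  with yA \<F>(2) show ?thesis by blast
qed

section \<open>The alcoved triangulation\<close>

lemma between_not_Ints:
  fixes x :: real
  assumes "of_int l < x" "x < of_int l + 1"
  shows "x \<notin> \<int>"
proof
  assume "x \<in> \<int>"
  then obtain k where "x = of_int k" by (elim Ints_cases)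
  with assms have "l < k" "k < l + 1" by linarith+
  then show False by simp
qed

section \<open>Generic points, cells and regions\<close>

text \<open>The second assumption makes \<open>P\<close> the intersection of the integral
  half-spaces that contain it. Equations appear as opposite pairs of half-spaces, so polytopes of
  smaller dimension need no separate treatment.\<close>

locale alcoved_body =
  fixes P :: "(real ^ 'n) set"
  assumes bounded: "bounded P"
    and halfspaces:
      "\<And>y. (\<And>i j l. (\<And>x. x \<in> P \<Longrightarrow> cdiff x i j \<le> of_int l) \<Longrightarrow> cdiff y i j \<le> of_int l) \<Longrightarrow> y \<in> P"
begin

text \<open>For \<open>i \<noteq> j\<close>, these are the pairs with a hyperplane through all of a
  nonempty \<open>P\<close>, which therefore does not dissect \<open>P\<close>.\<close>

definition tied :: "'n option \<Rightarrow> 'n option \<Rightarrow> bool" where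
  "tied i j \<longleftrightarrow> (\<exists>l::int. \<forall>x\<in>P. cdiff x i j = l)"

definition generic :: "(real ^ 'n) set" where
  "generic = {x \<in> P. \<forall>i j. \<not> tied i j \<longrightarrow> cdiff x i j \<notin> \<int>}"

text \<open>Membership in \<open>P\<close> is part of the definition because for a tied pair the two
  bounds alone would leave a slack of 1.\<close>

definition cell :: "real ^ 'n \<Rightarrow> (real ^ 'n) set" where
  "cell x = {y \<in> P. \<forall>i j. \<lfloor>cdiff x i j\<rfloor> \<le> cdiff y i j \<and> cdiff y i j \<le> \<lfloor>cdiff x i j\<rfloor> + 1}"

definition region :: "real ^ 'n \<Rightarrow> (real ^ 'n) set" where
  "region x = {y \<in> generic. \<forall>i j. \<lfloor>cdiff y i j\<rfloor> = \<lfloor>cdiff x i j\<rfloor>}"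

lemma convex: "convex P"
proof (rule convexI)
  fix x y u v assume xy: "x \<in> P" "y \<in> P" "0 \<le> u" "0 \<le> v" "u + v = (1::real)"
  show "u *\<^sub>R x + v *\<^sub>R y \<in> P"
  proof (rule halfspaces)
    fix i j l assume "\<And>x. x \<in> P \<Longrightarrow> cdiff x i j \<le> of_int l"
    then have "u * cdiff x i j + v * cdiff y i j \<le> l"
      using xy by (intro convex_bound_le) auto
    then show "cdiff (u *\<^sub>R x + v *\<^sub>R y) i j \<le> l"
      by (simp add: cdiff_inner inner_add_right)
  qed
qed

lemma closed: "closed P"
proof -
  have "P = (\<Inter>(i, j, l)\<in>{(i, j, l). \<forall>x\<in>P. cdiff x i j \<le> of_int l}. {y. cdiff y i j \<le> of_int l})"
    (is "P = ?Q")
  proof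
    show "?Q \<subseteq> P"
      by (rule subsetI, rule halfspaces) blast
  qed auto
  moreover have "closed ?Q"
    by (intro closed_INT) (auto intro!: closed_Collect_le continuous_intros)
  ultimately show ?thesis by simp
qed

lemma generic_subset: "generic \<subseteq> P"
  by (auto simp: generic_def)

lemma generic_in_P: "x \<in> generic \<Longrightarrow> x \<in> P"
  by (simp add: generic_def)

lemma genericD: "x \<in> generic \<Longrightarrow> \<not> tied i j \<Longrightarrow> cdiff x i j \<notin> \<int>"
  by (simp add: generic_def)

lemma tied_eq: "tied i j \<Longrightarrow> x \<in> P \<Longrightarrow> y \<in> P \<Longrightarrow> cdiff x i j = cdiff y i j"
  by (auto simp: tied_def)

lemma tied_Ints: "tied i j \<Longrightarrow> x \<in> P \<Longrightarrow> cdiff x i j \<in> \<int>"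
  by (auto simp: tied_def)

lemma tied_refl [simp]: "tied i i"
  by (auto simp: tied_def intro: exI[of _ 0])

lemma tied_sym: "tied i j \<Longrightarrow> tied j i"
  unfolding tied_def by (metis cdiff_swap of_int_minus)

lemma tied_trans: "tied i j \<Longrightarrow> tied j k \<Longrightarrow> tied i k"
  unfolding tied_def by (metis cdiff_add of_int_add)

lemma cell_subset: "cell x \<subseteq> P"
  by (auto simp: cell_def)

lemma mem_cell_self: "x \<in> P \<Longrightarrow> x \<in> cell x"
  unfolding cell_def by (auto intro: less_imp_le floor_correct)

text \<open>Only the upper bound could change the integer part. Genericity excludes it for untied
  pairs, and tied differences are constant on \<open>P\<close>.\<close>

lemma generic_cell_floor:
  assumes "x \<in> P" "y \<in> generic" "y \<in> cell x"
  shows "\<lfloor>cdiff y i j\<rfloor> = \<lfloor>cdiff x i j\<rfloor>"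
proof (cases "tied i j")
  case True
  with assms show ?thesis
    using tied_eq[of i j x y] generic_subset by auto
next
  case False
  with assms genericD have "cdiff y i j \<noteq> of_int (\<lfloor>cdiff x i j\<rfloor> + 1)"
    by (metis Ints_of_int)
  moreover have "\<lfloor>cdiff x i j\<rfloor> \<le> cdiff y i j" "cdiff y i j \<le> \<lfloor>cdiff x i j\<rfloor> + 1"
    using assms(3) by (auto simp: cell_def)
  ultimately show ?thesis by linarith
qed

lemma cell_cong: "(\<And>i j. \<lfloor>cdiff x i j\<rfloor> = \<lfloor>cdiff y i j\<rfloor>) \<Longrightarrow> cell x = cell y"
  by (simp add: cell_def)

lemma region_eq:
  assumes x: "x \<in> P"
  shows "region x = cell x \<inter> generic"
proof
  show "cell x \<inter> generic \<subseteq> region x"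
    using generic_cell_floor[OF x] by (auto simp: region_def)
  show "region x \<subseteq> cell x \<inter> generic"
  proof
    fix y assume y: "y \<in> region x"
    have "cell x = cell y"
      using y by (intro cell_cong) (simp add: region_def)
    with y show "y \<in> cell x \<inter> generic"
      using mem_cell_self generic_subset by (auto simp: region_def)
  qed
qed

lemma cell_eq_iff:
  assumes "x \<in> generic" "y \<in> generic"
  shows "cell x = cell y \<longleftrightarrow> (\<forall>i j. \<lfloor>cdiff x i j\<rfloor> = \<lfloor>cdiff y i j\<rfloor>)"
  using assms cell_cong generic_cell_floor mem_cell_self generic_subset by blast

lemma convex_cell: "convex (cell x)"
proof -
  have "cell x = P \<inter> (\<Inter>i. \<Inter>j. {y. (ext_axis i - ext_axis j) \<bullet> y \<ge> \<lfloor>cdiff x i j\<rfloor>} \<inter>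
      {y. (ext_axis i - ext_axis j) \<bullet> y \<le> \<lfloor>cdiff x i j\<rfloor> + 1})"
    by (auto simp: cell_def cdiff_inner)
  then show ?thesis
    by (auto intro!: convex_Int convex_INT convex convex_halfspace_le convex_halfspace_ge)
qed

lemma closed_cell: "closed (cell x)"
proof -
  have "cell x = P \<inter> (\<Inter>i. \<Inter>j. {y. (ext_axis i - ext_axis j) \<bullet> y \<ge> \<lfloor>cdiff x i j\<rfloor>} \<inter>
      {y. (ext_axis i - ext_axis j) \<bullet> y \<le> \<lfloor>cdiff x i j\<rfloor> + 1})"
    by (auto simp: cell_def cdiff_inner)
  then show ?thesis
    by (auto intro!: closed_Int closed_INT closed closed_halfspace_le closed_halfspace_ge)
qed

text \<open>For untied pairs the bounds are strict at \<open>x\<close> and weak at \<open>y\<close>,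
  hence strict at every combination that gives \<open>x\<close> positive weight. Closure and
  convexity of regions both follow from this.\<close>

lemma toward_region:
  assumes "x \<in> generic" "y \<in> cell x" "0 < e" "e \<le> 1"
  shows "y + e *\<^sub>R (x - y) \<in> region x"
proof -
  have xP: "x \<in> P" and yP: "y \<in> P"
    using assms generic_subset cell_subset by auto
  have P: "y + e *\<^sub>R (x - y) \<in> P"
    using toward_in_convex[OF convex yP xP] assms by simp
  have cell: "y + e *\<^sub>R (x - y) \<in> cell x"
    using toward_in_convex[OF convex_cell assms(2) mem_cell_self[OF xP]] assms by simp
  have "cdiff (y + e *\<^sub>R (x - y)) i j \<notin> \<int>" if "\<not> tied i j" for i j
  proof -
    let ?f = "real_of_int \<lfloor>cdiff x i j\<rfloor>"
    have y: "?f \<le> cdiff y i j" "cdiff y i j \<le> ?f + 1"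
      using assms(2) by (auto simp: cell_def)
    have x: "?f < cdiff x i j" "cdiff x i j < ?f + 1"
      using genericD[OF assms(1) that] floor_correct[of "cdiff x i j"]
      by (auto simp: less_le)
    have "0 < e * (cdiff x i j - ?f)" "0 \<le> (1 - e) * (cdiff y i j - ?f)"
      "0 < e * (?f + 1 - cdiff x i j)" "0 \<le> (1 - e) * (?f + 1 - cdiff y i j)"
      using x y assms by auto
    then have "?f < cdiff (y + e *\<^sub>R (x - y)) i j" "cdiff (y + e *\<^sub>R (x - y)) i j < ?f + 1"
      unfolding cdiff_toward by (simp_all add: algebra_simps)
    then show ?thesis
      by (rule between_not_Ints)
  qed
  with P have "y + e *\<^sub>R (x - y) \<in> generic"
    by (simp add: generic_def)
  with cell show ?thesis
    by (simp add: region_eq xP)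
qed

lemma closure_region:
  assumes "x \<in> generic"
  shows "closure (region x) = cell x"
proof
  have "region x \<subseteq> cell x"
    using assms generic_subset region_eq by blast
  then show "closure (region x) \<subseteq> cell x"
    by (rule closure_minimal) (rule closed_cell)
  show "cell x \<subseteq> closure (region x)"
  proof
    fix y assume y: "y \<in> cell x"
    have "((\<lambda>e. y + e *\<^sub>R (x - y)) \<longlongrightarrow> y + 0 *\<^sub>R (x - y)) (at_right 0)"
      by (intro tendsto_intros)
    moreover have "\<forall>\<^sub>F e in at_right 0. y + e *\<^sub>R (x - y) \<in> closure (region x)"
      using eventually_at_right_less eventually_at_right_real[of 0 1, simplified]
      by eventually_elim (meson assms closure_subset less_imp_le subsetD toward_region y)
    ultimately show "y \<in> closure (region x)"
      using Lim_in_closed_set[OF closed_closure] trivial_limit_at_right_real by fastforce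
  qed
qed

lemma convex_region: "x \<in> generic \<Longrightarrow> convex (region x)"
proof (rule convexI)
  fix a b u v assume x: "x \<in> generic" and ab: "a \<in> region x" "b \<in> region x"
    and uv: "0 \<le> u" "0 \<le> v" "u + v = (1::real)"
  have eq: "region b = region x" and bg: "b \<in> generic" and ac: "a \<in> cell b"
  proof -
    show "region b = region x" "b \<in> generic"
      using ab by (auto simp: region_def)
    have "cell b = cell a"
      using ab by (intro cell_cong) (simp add: region_def)
    then show "a \<in> cell b"
      using ab mem_cell_self generic_subset by (auto simp: region_def)
  qed
  show "u *\<^sub>R a + v *\<^sub>R b \<in> region x"
  proof (cases "v = 0")
    case True with uv ab show ?thesis by simp
  next
    case False
    \<comment> \<open>The end point \<open>b\<close> itself serves as the generic centre; this needs
      a positive weight on \<open>b\<close>, hence the separate case \<open>v = 0\<close>.\<close>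
    then have "a + v *\<^sub>R (b - a) \<in> region b"
      using uv by (intro toward_region bg ac) auto
    moreover have "u *\<^sub>R a + v *\<^sub>R b = a + v *\<^sub>R (b - a)"
      using uv(3) by (simp add: algebra_simps flip: scaleR_left.add)
    ultimately show ?thesis using eq by simp
  qed
qed

text \<open>A region is convex, hence connected. Leaving it changes the integer part of some untied
  difference, which by the intermediate value theorem would become an integer within the
  component.\<close>

lemma component_generic:
  assumes "x \<in> generic"
  shows "connected_component_set generic x = region x"
proof
  show "region x \<subseteq> connected_component_set generic x"
    by (rule connected_component_maximal)
      (use assms convex_connected[OF convex_region[OF assms]] in \<open>auto simp: region_def\<close>)
  show "connected_component_set generic x \<subseteq> region x"
  proof
    let ?C = "connected_component_set generic x"
    fix y assume y: "y \<in> ?C"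
    have C: "?C \<subseteq> generic" by (rule connected_component_subset)
    have x: "x \<in> ?C" using assms by simp
    have "\<lfloor>cdiff y i j\<rfloor> = \<lfloor>cdiff x i j\<rfloor>" for i j
    proof (rule ccontr)
      assume ne: "\<lfloor>cdiff y i j\<rfloor> \<noteq> \<lfloor>cdiff x i j\<rfloor>"
      then have nt: "\<not> tied i j"
        using tied_eq generic_in_P[OF subsetD[OF C x]] generic_in_P[OF subsetD[OF C y]] by metis
      have conn: "connected ((\<lambda>z. cdiff z i j) ` ?C)"
        by (intro connected_continuous_image continuous_intros) simp
      have "\<exists>l::int. of_int l \<in> (\<lambda>z. cdiff z i j) ` ?C"
      proof (cases "\<lfloor>cdiff y i j\<rfloor> < \<lfloor>cdiff x i j\<rfloor>")
        case True
        then have "cdiff y i j \<le> of_int \<lfloor>cdiff x i j\<rfloor>" "of_int \<lfloor>cdiff x i j\<rfloor> \<le> cdiff x i j"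
          by linarith+
        then show ?thesis
          using connectedD_interval[OF conn imageI[OF y] imageI[OF x]] by blast
      next
        case False
        with ne have "cdiff x i j \<le> of_int \<lfloor>cdiff y i j\<rfloor>" "of_int \<lfloor>cdiff y i j\<rfloor> \<le> cdiff y i j"
          by linarith+
        then show ?thesis
          using connectedD_interval[OF conn imageI[OF x] imageI[OF y]] by blast
      qed
      then obtain l z where z: "z \<in> ?C" "of_int l = cdiff z i j"
        by (elim exE imageE)
      have "cdiff z i j \<notin> \<int>"
        using genericD[OF subsetD[OF C z(1)] nt] .
      with z(2) show False
        by (metis Ints_of_int)
    qed
    with y C show "y \<in> region x"
      by (auto simp: region_def)
  qed
qed

lemma generic_eq: "P - \<Union>{H \<in> alcove_arrangement. \<not> P \<subseteq> H} = generic"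
proof
  show "P - \<Union>{H \<in> alcove_arrangement. \<not> P \<subseteq> H} \<subseteq> generic"
  proof
    fix x assume x: "x \<in> P - \<Union>{H \<in> alcove_arrangement. \<not> P \<subseteq> H}"
    have "cdiff x i j \<notin> \<int>" if "\<not> tied i j" for i j
    proof
      assume "cdiff x i j \<in> \<int>"
      then obtain l where l: "cdiff x i j = of_int l" by (elim Ints_cases)
      have "i \<noteq> j" using that by auto
      then have "alcove_hyperplane i j l \<in> alcove_arrangement"
        by (auto simp: alcove_arrangement_def)
      moreover have "\<not> P \<subseteq> alcove_hyperplane i j l"
        using that by (auto simp: tied_def alcove_hyperplane_cdiff)
      moreover have "x \<in> alcove_hyperplane i j l"
        using l by (simp add: alcove_hyperplane_cdiff)
      ultimately show False using x by blast
    qed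
    with x show "x \<in> generic" by (simp add: generic_def)
  qed
  show "generic \<subseteq> P - \<Union>{H \<in> alcove_arrangement. \<not> P \<subseteq> H}"
  proof
    fix x assume x: "x \<in> generic"
    have False if H: "H \<in> alcove_arrangement" "\<not> P \<subseteq> H" "x \<in> H" for H
    proof -
      obtain i j l where ijl: "H = alcove_hyperplane i j l"
        using H(1) by (auto simp: alcove_arrangement_def)
      have xl: "cdiff x i j = of_int l"
        using H(3) by (simp add: ijl alcove_hyperplane_cdiff)
      then have "tied i j" using genericD[OF x] by (metis Ints_of_int)
      then have "P \<subseteq> H"
        using xl tied_eq[OF _ _ generic_in_P[OF x]] by (auto simp: ijl alcove_hyperplane_cdiff)
      with H(2) show False by simp
    qed
    with x generic_subset show "x \<in> P - \<Union>{H \<in> alcove_arrangement. \<not> P \<subseteq> H}" by blast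
  qed
qed

lemma alcoved_triangulation_eq: "alcoved_triangulation P = cell ` generic"
  unfolding alcoved_triangulation_def generic_eq components_def image_image
  by (rule image_cong) (simp_all add: component_generic closure_region)

lemma bounded_floor:
  obtains B where "\<And>x i j. x \<in> P \<Longrightarrow> \<lfloor>cdiff x i j\<rfloor> \<in> {-B..B}"
proof -
  obtain K where K: "\<And>x. x \<in> P \<Longrightarrow> norm x \<le> K"
    using bounded by (auto simp: bounded_iff)
  have "\<bar>ext_coord x i\<bar> \<le> \<bar>K\<bar>" if "x \<in> P" for x i
  proof (cases i)
    case (Some m)
    then show ?thesis using component_le_norm_cart[of x m] K[OF that] by simp
  qed simp
  note K' = this
  have *: "\<bar>cdiff x i j\<bar> \<le> 2 * \<bar>K\<bar>" if "x \<in> P" for x i j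
    unfolding cdiff_def using abs_triangle_ineq4[of "ext_coord x i" "ext_coord x j"]
      K'[OF that, of i] K'[OF that, of j] by linarith
  have "\<lfloor>cdiff x i j\<rfloor> \<in> {- (\<lceil>2 * \<bar>K\<bar>\<rceil> + 1)..\<lceil>2 * \<bar>K\<bar>\<rceil> + 1}" if "x \<in> P" for x i j
  proof -
    have "-(2 * \<bar>K\<bar>) \<le> cdiff x i j" "cdiff x i j \<le> 2 * \<bar>K\<bar>"
      using *[OF that, of i j] by linarith+
    then show ?thesis by (simp add: le_floor_iff floor_le_iff) linarith
  qed
  then show ?thesis by (rule that)
qed

text \<open>A cell depends only on the integer parts of the differences, and boundedness confines
  these to a finite range.\<close>

lemma finite_cells: "finite (cell ` generic)"
proof -
  obtain B where B: "\<And>x i j. x \<in> P \<Longrightarrow> \<lfloor>cdiff x i j\<rfloor> \<in> {-B..B}"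
    using bounded_floor by blast
  let ?g = "\<lambda>f. {y \<in> P. \<forall>i j. of_int (f (i, j)) \<le> cdiff y i j \<and> cdiff y i j \<le> of_int (f (i, j)) + 1}"
  have "cell ` generic \<subseteq> ?g ` (UNIV \<rightarrow>\<^sub>E {-B..B})"
  proof (rule image_subsetI)
    fix x assume "x \<in> generic"
    then have "(\<lambda>(i, j). \<lfloor>cdiff x i j\<rfloor>) \<in> UNIV \<rightarrow>\<^sub>E {-B..B}"
      using B generic_subset by auto
    then show "cell x \<in> ?g ` (UNIV \<rightarrow>\<^sub>E {-B..B})"
      by (intro image_eqI[where x = "\<lambda>(i, j). \<lfloor>cdiff x i j\<rfloor>"]) (auto simp: cell_def)
  qed
  moreover have "finite ((UNIV :: ('n option \<times> 'n option) set) \<rightarrow>\<^sub>E {-B..B})"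
    by (intro finite_PiE) auto
  ultimately show ?thesis by (meson finite_imageI finite_subset)
qed

end

section \<open>Affine hull and barycentric coordinates\<close>

lemma affine_toward:
  assumes "affine S" "x \<in> S" "y \<in> S"
  shows "x + e *\<^sub>R (y - x) \<in> S"
  using mem_affine[OF assms, of "1 - e" e] by (simp add: algebra_simps)

lemma sorted_enumeration:
  fixes f :: "'a \<Rightarrow> 'b::linorder"
  assumes "finite S" "inj_on f S"
  obtains e where "bij_betw e {..<card S} S" "\<And>a b. a < b \<Longrightarrow> b < card S \<Longrightarrow> f (e a) < f (e b)"
proof -
  define xs where "xs = sorted_list_of_set (f ` S)"
  have xs: "set xs = f ` S" "length xs = card S" "sorted_wrt (<) xs"
    using assms by (auto simp: xs_def card_image)
  define e where "e = (\<lambda>a. inv_into S f (xs ! a))"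
  have nth: "xs ! a \<in> f ` S" if "a < card S" for a
    using that xs nth_mem by metis
  have fe: "f (e a) = xs ! a" if "a < card S" for a
    using nth[OF that] by (simp add: e_def f_inv_into_f)
  have less: "f (e a) < f (e b)" if "a < b" "b < card S" for a b
    using that xs(2,3) by (simp add: fe sorted_wrt_nth_less)
  have inj: "inj_on e {..<card S}"
    by (rule linorder_inj_onI') (use less in fastforce)
  have "e ` {..<card S} \<subseteq> S"
    using nth by (auto simp: e_def inv_into_into)
  moreover have "card (e ` {..<card S}) = card S"
    using inj by (simp add: card_image)
  ultimately have "e ` {..<card S} = S"
    using assms(1) card_subset_eq by blast
  with inj less show ?thesis
    by (intro that[of e]) (auto simp: bij_betw_def)
qed

section \<open>Classes of tied indices and the affine hull\<close>

context alcoved_body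
begin

text \<open>For a polytope of smaller dimension only one index of each class of tied indices matters;
  \<^const>\<open>None\<close> represents its own class.\<close>

definition rep :: "'n option \<Rightarrow> 'n option" where
  "rep i = (if tied i None then None else SOME j. tied i j)"

definition reps :: "'n option set" where
  "reps = range rep"

lemma tied_rep: "tied i (rep i)"
  unfolding rep_def by (auto intro: someI[of "tied i", OF tied_refl])

lemma rep_eq_iff: "rep i = rep j \<longleftrightarrow> tied i j"
proof
  assume "rep i = rep j"
  then show "tied i j"
    using tied_rep[of i] tied_rep[of j] tied_sym tied_trans by metis
next
  assume "tied i j"
  then have "tied i = tied j"
    using tied_sym tied_trans by blast
  then show "rep i = rep j" by (simp add: rep_def)
qed

lemma rep_rep [simp]: "rep (rep i) = rep i"
  using rep_eq_iff tied_rep tied_sym by blast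

lemma rep_None [simp]: "rep None = None"
  by (simp add: rep_def)

lemma rep_in_reps [simp]: "rep i \<in> reps"
  by (simp add: reps_def)

lemma rep_of_reps [simp]: "i \<in> reps \<Longrightarrow> rep i = i"
  by (auto simp: reps_def)

lemma None_in_reps [simp]: "None \<in> reps"
  by (metis rep_None rep_in_reps)

lemma finite_reps [simp]: "finite reps"
  by (rule finite)

lemma card_reps_pos [simp]: "0 < card reps"
  unfolding card_gt_0_iff using None_in_reps finite_reps by (metis empty_iff)

lemma reps_untied: "i \<in> reps \<Longrightarrow> j \<in> reps \<Longrightarrow> i \<noteq> j \<Longrightarrow> \<not> tied i j"
  by (metis rep_eq_iff rep_of_reps)

text \<open>Given by the tied equations alone, it contains \<open>P\<close> and has the same
  dimension as soon as a generic point exists, so it stands for the affine hull.\<close>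

definition flat :: "(real ^ 'n) set" where
  "flat = {y. \<forall>i. \<forall>x\<in>P. cdiff y i (rep i) = cdiff x i (rep i)}"

lemma P_subset_flat: "P \<subseteq> flat"
  unfolding flat_def using tied_eq[OF tied_rep] by blast

lemma generic_in_flat: "x \<in> generic \<Longrightarrow> x \<in> flat"
  using generic_in_P P_subset_flat by blast

lemma affine_flat: "affine flat"
proof -
  have "flat = (\<Inter>i. \<Inter>x\<in>P. {y. (ext_axis i - ext_axis (rep i)) \<bullet> y = cdiff x i (rep i)})"
    by (auto simp: flat_def cdiff_inner)
  then show ?thesis
    by (auto intro!: affine_Inter affine_hyperplane)
qed

text \<open>The shift \<open>c\<close> is integral and the same for all points of
  \<open>flat\<close>, so floors and integrality of a difference can be read off from the
  representatives.\<close>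

lemma flat_cdiff_rep:
  assumes "x \<in> P"
  obtains c :: int where "\<And>y. y \<in> flat \<Longrightarrow> cdiff y i j = cdiff y (rep i) (rep j) + c"
proof -
  have "cdiff x i (rep i) \<in> \<int>" "cdiff x j (rep j) \<in> \<int>"
    using assms tied_Ints tied_rep by auto
  then obtain a b where ab: "cdiff x i (rep i) = of_int a" "cdiff x j (rep j) = of_int b"
    by (elim Ints_cases)
  have "cdiff y i j = cdiff y (rep i) (rep j) + of_int (a - b)" if "y \<in> flat" for y
  proof -
    have "cdiff y i (rep i) = of_int a" "cdiff y j (rep j) = of_int b"
      using that assms ab by (auto simp: flat_def)
    then show ?thesis by (simp add: cdiff_def)
  qed
  then show ?thesis by (rule that)
qed

text \<open>Representatives have independent coordinates on \<open>flat\<close>. Subtracting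
  \<open>g None\<close> respects the convention that the coordinate at \<open>None\<close> is 0 and
  leaves all differences of \<open>g\<close> unchanged.\<close>

lemma ex_flat_point:
  assumes "x \<in> P"
  obtains y where "y \<in> flat" "\<And>i. i \<in> reps \<Longrightarrow> ext_coord y i = g i - g None"
proof -
  define y :: "real ^ 'n" where
    "y = (\<chi> m. g (rep (Some m)) - g None + cdiff x (Some m) (rep (Some m)))"
  have y: "ext_coord y i = g (rep i) - g None + cdiff x i (rep i)" for i
    by (cases i) (simp_all add: y_def)
  have "cdiff y i (rep i) = cdiff x' i (rep i)" if "x' \<in> P" for i x'
  proof -
    have "cdiff y i (rep i) = cdiff x i (rep i)"
      using y[of i] y[of "rep i"] by (simp add: cdiff_def)
    also have "\<dots> = cdiff x' i (rep i)"
      by (rule tied_eq[OF tied_rep assms that])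
    finally show ?thesis .
  qed
  then have "y \<in> flat" by (simp add: flat_def)
  moreover have "ext_coord y i = g i - g None" if "i \<in> reps" for i
    using y[of i] that by simp
  ultimately show ?thesis by (rule that)
qed

text \<open>The direction space of \<open>flat\<close> has as basis the indicator vectors of the
  classes other than that of \<open>None\<close>; their supports are disjoint, so they are
  orthogonal.\<close>

lemma aff_dim_flat:
  assumes x: "x \<in> P"
  shows "aff_dim flat = int (card reps) - 1"
proof -
  define b :: "'n option \<Rightarrow> real ^ 'n" where "b = (\<lambda>k. \<chi> m. if rep (Some m) = k then 1 else 0)"
  define B where "B = b ` (reps - {None})"
  define L where "L = (\<lambda>y. y - x) ` flat"
  have xf: "x \<in> flat" using x P_subset_flat by blast
  have own: "\<exists>m. k = Some m \<and> b k $ m = 1 \<and> (\<forall>k'. k' \<noteq> k \<longrightarrow> b k' $ m = 0)"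
    if k: "k \<in> reps - {None}" for k
  proof -
    obtain m where "k = Some m" using k by auto
    moreover from this k have "rep (Some m) = k" by auto
    ultimately show ?thesis by (auto simp: b_def)
  qed
  have inj: "inj_on b (reps - {None})"
  proof (rule inj_onI)
    fix k k' assume k: "k \<in> reps - {None}" and "b k = b k'"
    then show "k = k'"
      using own[OF k] by (metis zero_neq_one)
  qed
  have L_coord: "ext_coord z i = ext_coord z (rep i)" if z: "z \<in> L" for z i
  proof -
    obtain y where "y \<in> flat" "z = y - x" using z by (auto simp: L_def)
    then have "cdiff y i (rep i) = cdiff x i (rep i)" using x by (auto simp: flat_def)
    with \<open>z = y - x\<close> have "cdiff z i (rep i) = 0"
      by (simp add: cdiff_inner inner_diff_right)
    then show ?thesis by (simp add: cdiff_def)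
  qed
  have "B \<subseteq> L"
  proof
    fix z assume "z \<in> B"
    then obtain k where k: "k \<in> reps - {None}" "z = b k" unfolding B_def by blast
    have "ext_coord (b k) i = ext_coord (b k) (rep i)" for i
    proof (cases i)
      case None then show ?thesis by simp
    next
      case (Some m)
      show ?thesis
      proof (cases "rep i")
        case None
        with Some k show ?thesis by (auto simp: b_def)
      next
        case (Some m')
        then have "rep (Some m') = rep (Some m)"
          using \<open>i = Some m\<close> by (metis rep_rep)
        with Some \<open>i = Some m\<close> show ?thesis by (simp add: b_def)
      qed
    qed
    then have "cdiff (b k) i (rep i) = 0" for i
      by (simp add: cdiff_def)
    then have "cdiff (x + b k) i (rep i) = cdiff x i (rep i)" for i
      by (simp add: cdiff_inner inner_add_right)
    with xf have "x + b k \<in> flat" by (simp add: flat_def)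
    then show "z \<in> L" unfolding L_def k(2) by (intro image_eqI[of _ _ "x + b k"]) auto
  qed
  moreover have "L \<subseteq> span B"
  proof
    fix z assume z: "z \<in> L"
    have "z = (\<Sum>k\<in>reps - {None}. ext_coord z k *\<^sub>R b k)"
    proof (subst vec_eq_iff, rule allI)
      fix m
      have "(\<Sum>k\<in>reps - {None}. ext_coord z k *\<^sub>R b k) $ m =
          (\<Sum>k\<in>reps - {None}. if k = rep (Some m) then ext_coord z k else 0)"
        unfolding sum_component by (rule sum.cong) (auto simp: b_def)
      also have "\<dots> = (if rep (Some m) \<in> reps - {None} then ext_coord z (rep (Some m)) else 0)"
        by (subst sum.delta) auto
      also have "\<dots> = ext_coord z (rep (Some m))"
        by auto
      also have "\<dots> = z $ m"
        using L_coord[OF z, of "Some m"] by simp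
      finally show "z $ m = (\<Sum>k\<in>reps - {None}. ext_coord z k *\<^sub>R b k) $ m" by simp
    qed
    also have "\<dots> \<in> span B"
      by (intro span_sum span_scale span_base) (auto simp: B_def)
    finally show "z \<in> span B" .
  qed
  moreover have "independent B"
  proof (rule pairwise_orthogonal_independent)
    show "pairwise orthogonal B"
      by (auto simp: pairwise_def orthogonal_def B_def b_def inner_vec_def intro!: sum.neutral)
    show "0 \<notin> B"
      unfolding B_def using own by (metis imageE zero_index zero_neq_one)
  qed
  ultimately have "card B = dim L"
    using basis_card_eq_dim by blast
  moreover have "card B = card reps - 1"
    unfolding B_def using inj by (simp add: card_image)
  moreover have "aff_dim flat = int (dim L)"
    unfolding L_def by (rule aff_dim_dim_affine_diffs[OF affine_flat xf])
  ultimately show ?thesis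
    using card_reps_pos by linarith
qed

text \<open>Reduces membership to pairs of distinct representatives; the remaining pairs follow by
  integral shifts, and membership in \<open>P\<close> comes for free.\<close>

lemma flat_mem_cell:
  assumes x: "x \<in> generic" and y: "y \<in> flat"
    and bounds: "\<And>i j. i \<in> reps \<Longrightarrow> j \<in> reps \<Longrightarrow> i \<noteq> j \<Longrightarrow>
      \<lfloor>cdiff x i j\<rfloor> \<le> cdiff y i j \<and> cdiff y i j \<le> \<lfloor>cdiff x i j\<rfloor> + 1"
  shows "y \<in> cell x"
proof -
  have xP: "x \<in> P" and xf: "x \<in> flat"
    using x generic_in_P generic_in_flat by auto
  have all: "\<lfloor>cdiff x i j\<rfloor> \<le> cdiff y i j \<and> cdiff y i j \<le> \<lfloor>cdiff x i j\<rfloor> + 1" for i j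
  proof -
    obtain c :: int where c: "\<And>y. y \<in> flat \<Longrightarrow> cdiff y i j = cdiff y (rep i) (rep j) + c"
      using flat_cdiff_rep[OF xP] by blast
    show ?thesis
    proof (cases "rep i = rep j")
      case True
      then show ?thesis using c[OF y] c[OF xf] by simp
    next
      case False
      then show ?thesis using bounds[of "rep i" "rep j"] c[OF y] c[OF xf] by simp
    qed
  qed
  have "y \<in> P"
  proof (rule halfspaces)
    fix i j l assume le: "\<And>x. x \<in> P \<Longrightarrow> cdiff x i j \<le> of_int l"
    show "cdiff y i j \<le> of_int l"
    proof (cases "tied i j")
      case True
      obtain c :: int where c: "\<And>y. y \<in> flat \<Longrightarrow> cdiff y i j = cdiff y (rep i) (rep j) + c"
        using flat_cdiff_rep[OF xP] by blast
      have "rep i = rep j" using True rep_eq_iff by blast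
      then have "cdiff y i j = cdiff x i j"
        using c[OF y] c[OF xf] by simp
      with le[OF xP] show ?thesis by simp
    next
      case False
      have "cdiff x i j \<noteq> of_int l"
        using genericD[OF x False] by (metis Ints_of_int)
      with le[OF xP] have "cdiff x i j < of_int l" by simp
      then have "\<lfloor>cdiff x i j\<rfloor> < l" by (simp add: floor_less_iff)
      \<comment> \<open>Here the integrality of \<open>l\<close> enters: a bound strictly above
        \<open>cdiff x i j\<close> is at least the next integer, which bounds the whole
        cell.\<close>
      then have "real_of_int (\<lfloor>cdiff x i j\<rfloor> + 1) \<le> of_int l"
        by (subst of_int_le_iff) simp
      with all[of i j] show ?thesis by linarith
    qed
  qed
  with all show ?thesis by (simp add: cell_def)
qed

text \<open>Strict bounds between representatives describe an open neighbourhood of \<open>x\<close>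
  whose trace on \<open>flat\<close> lies in the cell.\<close>

lemma aff_dim_cell:
  assumes x: "x \<in> generic"
  shows "aff_dim (cell x) = aff_dim flat"
proof (rule antisym)
  show "aff_dim (cell x) \<le> aff_dim flat"
    using cell_subset P_subset_flat by (intro aff_dim_subset) blast
  define U where "U = (\<Inter>i. \<Inter>j. {y. i \<in> reps \<and> j \<in> reps \<and> i \<noteq> j \<longrightarrow>
    \<lfloor>cdiff x i j\<rfloor> < cdiff y i j \<and> cdiff y i j < \<lfloor>cdiff x i j\<rfloor> + 1})"
  have "open U"
    unfolding U_def
    by (intro open_INT ballI finite open_Collect_imp open_Collect_conj open_Collect_less
        continuous_on_cdiff continuous_on_const closed_Collect_const)
  have "x \<in> U"
  proof -
    have "\<lfloor>cdiff x i j\<rfloor> < cdiff x i j \<and> cdiff x i j < \<lfloor>cdiff x i j\<rfloor> + 1"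
      if "i \<in> reps" "j \<in> reps" "i \<noteq> j" for i j
      using genericD[OF x reps_untied[OF that]] floor_correct[of "cdiff x i j"]
      by (auto simp: less_le)
    then show ?thesis by (auto simp: U_def)
  qed
  have "flat \<inter> U \<subseteq> cell x"
  proof
    fix y assume "y \<in> flat \<inter> U"
    then show "y \<in> cell x"
      unfolding U_def by (intro flat_mem_cell[OF x]) (blast intro: less_imp_le)+
  qed
  then have "aff_dim (flat \<inter> U) \<le> aff_dim (cell x)"
    by (rule aff_dim_subset)
  moreover have "aff_dim (flat \<inter> U) = aff_dim flat"
    using \<open>open U\<close> \<open>x \<in> U\<close> generic_in_flat[OF x]
    by (intro aff_dim_openin affine_flat) (auto simp: openin_open)
  ultimately show "aff_dim flat \<le> aff_dim (cell x)" by simp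
qed

lemma aff_dim_P:
  assumes "generic \<noteq> {}"
  shows "aff_dim P = int (card reps) - 1"
proof -
  obtain x where x: "x \<in> generic" using assms by blast
  have "aff_dim (cell x) \<le> aff_dim P" "aff_dim P \<le> aff_dim flat"
    by (intro aff_dim_subset cell_subset P_subset_flat)+
  with aff_dim_cell[OF x] aff_dim_flat[OF generic_in_P[OF x]] show ?thesis by simp
qed


section \<open>Barycentric coordinates from the cyclic order\<close>

text \<open>Modulo 1, the coordinates of a generic point indexed by \<^const>\<open>reps\<close> are distinct points
  on a circle, and \<open>enum x\<close> lists them in cyclic order starting at 0.  The barycentric coordinates
  \<open>bary x y\<close> with respect to the vertices of the simplex around \<open>x\<close> are the lengths of the arcs
  between consecutive points.\<close>

definition enum :: "real ^ 'n \<Rightarrow> nat \<Rightarrow> 'n option" where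
  "enum x = (SOME e. bij_betw e {..<card reps} reps \<and> e 0 = None \<and>
     (\<forall>a b. a < b \<longrightarrow> b < card reps \<longrightarrow> frac (ext_coord x (e a)) < frac (ext_coord x (e b))))"

text \<open>The integer part is that of \<open>x\<close>, not of \<open>y\<close>, which makes the
  position of the \<open>m\<close>-th point an affine function of \<open>y\<close>. The value 1 past
  the last index closes the circle.\<close>

definition lev :: "real ^ 'n \<Rightarrow> real ^ 'n \<Rightarrow> nat \<Rightarrow> real" where
  "lev x y m = (if m < card reps then ext_coord y (enum x m) - \<lfloor>ext_coord x (enum x m)\<rfloor> else 1)"

definition bary :: "real ^ 'n \<Rightarrow> real ^ 'n \<Rightarrow> nat \<Rightarrow> real" where
  "bary x y m = lev x y (Suc m) - lev x y m"

text \<open>Equal fractional parts would give an integral difference of untied indices, so sorting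
  is strict. \<open>None\<close> has fractional part 0 and must come at the start.\<close>

lemma ex_enum:
  assumes x: "x \<in> generic"
  shows "\<exists>e. bij_betw e {..<card reps} reps \<and> e 0 = None \<and>
     (\<forall>a b. a < b \<longrightarrow> b < card reps \<longrightarrow> frac (ext_coord x (e a)) < frac (ext_coord x (e b)))"
proof -
  have "inj_on (\<lambda>i. frac (ext_coord x i)) reps"
  proof (rule inj_onI, rule ccontr)
    fix i j assume ij: "i \<in> reps" "j \<in> reps" "frac (ext_coord x i) = frac (ext_coord x j)" "i \<noteq> j"
    then have "cdiff x i j = of_int (\<lfloor>ext_coord x i\<rfloor> - \<lfloor>ext_coord x j\<rfloor>)"
      by (simp add: frac_def cdiff_def)
    with genericD[OF x reps_untied[OF ij(1,2,4)]] show False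
      by (metis Ints_of_int)
  qed
  with finite_reps obtain e where e: "bij_betw e {..<card reps} reps"
    "\<And>a b. a < b \<Longrightarrow> b < card reps \<Longrightarrow> frac (ext_coord x (e a)) < frac (ext_coord x (e b))"
    by (rule sorted_enumeration) blast
  obtain a where a: "a < card reps" "e a = None"
    using e(1) None_in_reps unfolding bij_betw_def by (metis imageE lessThan_iff)
  have "a = 0"
  proof (rule ccontr)
    assume "a \<noteq> 0"
    then have "frac (ext_coord x (e 0)) < 0"
      using e(2)[of 0 a] a by simp
    with frac_ge_0[of "ext_coord x (e 0)"] show False by linarith
  qed
  with e a show ?thesis by blast
qed

lemma
  assumes "x \<in> generic"
  shows bij_enum: "bij_betw (enum x) {..<card reps} reps"
    and enum_0: "enum x 0 = None"
    and enum_frac_less: "\<And>a b. a < b \<Longrightarrow> b < card reps \<Longrightarrow>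
      frac (ext_coord x (enum x a)) < frac (ext_coord x (enum x b))"
  using someI_ex[OF ex_enum[OF assms]] unfolding enum_def by blast+

lemma enum_in_reps: "x \<in> generic \<Longrightarrow> a < card reps \<Longrightarrow> enum x a \<in> reps"
  using bij_enum bij_betwE by blast

lemma enum_eq_iff:
  "x \<in> generic \<Longrightarrow> a < card reps \<Longrightarrow> b < card reps \<Longrightarrow> enum x a = enum x b \<longleftrightarrow> a = b"
  using bij_betw_imp_inj_on[OF bij_enum] by (auto dest: inj_onD)

lemma ex_enum_index:
  assumes "x \<in> generic" "i \<in> reps"
  obtains a where "a < card reps" "i = enum x a"
  using bij_enum[OF assms(1)] assms(2) unfolding bij_betw_def by (metis imageE lessThan_iff)

lemma lev_0: "x \<in> generic \<Longrightarrow> lev x y 0 = 0"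
  by (simp add: lev_def enum_0)

lemma sum_bary_lessThan: "x \<in> generic \<Longrightarrow> (\<Sum>m<a. bary x y m) = lev x y a"
  by (simp add: bary_def sum_lessThan_telescope lev_0)

lemma sum_bary: "x \<in> generic \<Longrightarrow> (\<Sum>m<card reps. bary x y m) = 1"
  by (simp add: sum_bary_lessThan lev_def)

lemma sum_bary_ivl: "a \<le> b \<Longrightarrow> (\<Sum>m=a..<b. bary x y m) = lev x y b - lev x y a"
  unfolding bary_def by (rule sum_Suc_diff')

text \<open>The fractional part at \<open>b\<close> exceeds that at \<open>a\<close>, so one floor
  is the difference of the floors; in the reverse order a carry of -1 appears, and the complementary
  arc is left over.\<close>

lemma cdiff_enum:
  assumes x: "x \<in> generic" and ab: "a < b" "b < card reps"
  shows "cdiff y (enum x b) (enum x a) = \<lfloor>cdiff x (enum x b) (enum x a)\<rfloor> + (lev x y b - lev x y a)"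
    and "cdiff y (enum x a) (enum x b) =
      \<lfloor>cdiff x (enum x a) (enum x b)\<rfloor> + (1 - (lev x y b - lev x y a))"
proof -
  let ?a = "ext_coord x (enum x a)" and ?b = "ext_coord x (enum x b)"
  have f: "frac ?a < frac ?b" "0 \<le> frac ?a" "frac ?b < 1"
    using enum_frac_less[OF x ab] frac_ge_0 frac_lt_1 by auto
  have "\<lfloor>cdiff x (enum x b) (enum x a)\<rfloor> = \<lfloor>?b\<rfloor> - \<lfloor>?a\<rfloor>"
    using f unfolding cdiff_def frac_def
    by (intro floor_unique; simp only: of_int_diff of_int_1; linarith)
  then show "cdiff y (enum x b) (enum x a) =
      \<lfloor>cdiff x (enum x b) (enum x a)\<rfloor> + (lev x y b - lev x y a)"
    using ab by (simp add: lev_def cdiff_def)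
  have "\<lfloor>cdiff x (enum x a) (enum x b)\<rfloor> = \<lfloor>?a\<rfloor> - \<lfloor>?b\<rfloor> - 1"
    using f unfolding cdiff_def frac_def
    by (intro floor_unique; simp only: of_int_diff of_int_1; linarith)
  then show "cdiff y (enum x a) (enum x b) =
      \<lfloor>cdiff x (enum x a) (enum x b)\<rfloor> + (1 - (lev x y b - lev x y a))"
    using ab by (simp add: lev_def cdiff_def)
qed

text \<open>\<open>M\<close> is the arc leading from \<open>j\<close> to \<open>i\<close> in cyclic
  direction. Being neither empty nor the full circle, it yields a value strictly between 0 and 1
  when all arcs are positive.\<close>

lemma cdiff_arc:
  assumes x: "x \<in> generic" and ij: "i \<in> reps" "j \<in> reps" "i \<noteq> j"
  obtains M where "M \<noteq> {}" "M \<subset> {..<card reps}"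
    "\<And>y. cdiff y i j = \<lfloor>cdiff x i j\<rfloor> + (\<Sum>m\<in>M. bary x y m)"
proof -
  obtain a b where a: "a < card reps" "i = enum x a" and b: "b < card reps" "j = enum x b"
    using ex_enum_index[OF x] ij by metis
  consider "a < b" | "b < a" using a b ij by (metis nat_neq_iff)
  then show ?thesis
  proof cases
    case 1
    have arc: "(\<Sum>m\<in>{..<card reps} - {a..<b}. bary x y m) = 1 - (lev x y b - lev x y a)" for y
      using 1 b sum_bary[OF x, of y] by (subst sum_diff) (auto simp: sum_bary_ivl)
    \<comment> \<open>Here the arc wraps around 0, so it always contains the last index; the index
      \<open>a\<close> is always missing.\<close>
    have mem: "card reps - 1 \<in> {..<card reps} - {a..<b}" "a \<notin> {..<card reps} - {a..<b}"
      using 1 b by auto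
    show ?thesis
    proof (rule that)
      show "{..<card reps} - {a..<b} \<noteq> {}" using mem(1) by blast
      show "{..<card reps} - {a..<b} \<subset> {..<card reps}" using mem(2) a(1) by blast
      show "cdiff y i j = \<lfloor>cdiff x i j\<rfloor> + (\<Sum>m\<in>{..<card reps} - {a..<b}. bary x y m)" for y
        unfolding arc a(2) b(2) by (rule cdiff_enum(2)[OF x 1 b(1)])
    qed
  next
    case 2
    have mem: "b \<in> {b..<a}" "card reps - 1 \<notin> {b..<a}" "{b..<a} \<subseteq> {..<card reps}"
      using 2 a by auto
    show ?thesis
    proof (rule that)
      show "{b..<a} \<noteq> {}" using mem(1) by blast
      show "{b..<a} \<subset> {..<card reps}"
        using mem(2,3) card_reps_pos by (metis diff_less lessThan_iff psubsetI zero_less_one)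
      show "cdiff y i j = \<lfloor>cdiff x i j\<rfloor> + (\<Sum>m=b..<a. bary x y m)" for y
        unfolding sum_bary_ivl[OF less_imp_le[OF 2]] a(2) b(2) by (rule cdiff_enum(1)[OF x 2 a(1)])
    qed
  qed
qed

text \<open>Each facet lies on a hyperplane of the arrangement, given by two cyclic neighbours; for
  the last arc the successor is \<open>None\<close>. With a single class there is no pair
  \<open>i \<noteq> j\<close>, hence the bound on \<open>card reps\<close>.\<close>

lemma bary_facet:
  assumes x: "x \<in> generic" and N: "1 < card reps" and m: "m < card reps"
  obtains i j where "i \<in> reps" "j \<in> reps" "i \<noteq> j"
    "\<And>y. bary x y m = cdiff y i j - \<lfloor>cdiff x i j\<rfloor>"
proof (cases "Suc m < card reps")
  case True
  show ?thesis
  proof (rule that)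
    show "enum x (Suc m) \<in> reps" "enum x m \<in> reps" "enum x (Suc m) \<noteq> enum x m"
      using True m enum_in_reps[OF x] enum_eq_iff[OF x] by auto
    show "bary x y m = cdiff y (enum x (Suc m)) (enum x m) -
        \<lfloor>cdiff x (enum x (Suc m)) (enum x m)\<rfloor>" for y
      using cdiff_enum(1)[OF x _ True, of m y] by (simp add: bary_def)
  qed
next
  case False
  with m have last: "Suc m = card reps" by simp
  with N have "0 < m" by simp
  show ?thesis
  proof (rule that)
    show "enum x 0 \<in> reps" "enum x m \<in> reps" "enum x 0 \<noteq> enum x m"
      using m \<open>0 < m\<close> enum_in_reps[OF x] enum_eq_iff[OF x] by auto
    show "bary x y m = cdiff y (enum x 0) (enum x m) - \<lfloor>cdiff x (enum x 0) (enum x m)\<rfloor>" for y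
      using cdiff_enum(2)[OF x \<open>0 < m\<close> m, of y] last
      by (simp add: bary_def lev_0[OF x]) (simp add: lev_def)
  qed
qed

lemma bary_point:
  assumes x: "x \<in> generic" and N: "card reps = 1"
  shows "bary x y 0 = 1"
  using sum_bary[OF x, of y] N by simp

lemma bary_generic_nonzero:
  assumes "x \<in> generic" "z \<in> generic" "m < card reps"
  shows "bary x z m \<noteq> 0"
proof (cases "card reps = 1")
  case True
  with assms bary_point[OF assms(1) True, of z] show ?thesis by simp
next
  case False
  with assms(3) have N: "1 < card reps" by simp
  obtain i j where ij: "i \<in> reps" "j \<in> reps" "i \<noteq> j"
    "\<And>y. bary x y m = cdiff y i j - \<lfloor>cdiff x i j\<rfloor>"
    using bary_facet[OF assms(1) N assms(3)] by blast
  show ?thesis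
    using genericD[OF assms(2) reps_untied[OF ij(1-3)]] ij(4)[of z] by (metis Ints_of_int eq_iff_diff_eq_0)
qed

lemma bary_toward:
  assumes "x \<in> generic" "m < card reps"
  shows "bary x (y + e *\<^sub>R (z - y)) m = bary x y m + e * (bary x z m - bary x y m)"
proof (cases "card reps = 1")
  case True
  with assms bary_point[OF assms(1) True] show ?thesis by simp
next
  case False
  with assms(2) have N: "1 < card reps" by simp
  obtain i j where ij: "\<And>y. bary x y m = cdiff y i j - \<lfloor>cdiff x i j\<rfloor>"
    using bary_facet[OF assms(1) N assms(2)] by blast
  show ?thesis by (simp add: ij cdiff_toward)
qed

text \<open>The bounds of a cell range over all pairs, but only cyclically consecutive ones matter:
  every other difference is a floor plus a partial sum of nonnegative numbers with total 1.\<close>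

lemma mem_cell_iff:
  assumes x: "x \<in> generic" and y: "y \<in> flat"
  shows "y \<in> cell x \<longleftrightarrow> (\<forall>m<card reps. 0 \<le> bary x y m)"
proof
  assume cell: "y \<in> cell x"
  show "\<forall>m<card reps. 0 \<le> bary x y m"
  proof (intro allI impI)
    fix m assume m: "m < card reps"
    show "0 \<le> bary x y m"
    proof (cases "card reps = 1")
      case True
      with m bary_point[OF x True, of y] show ?thesis by simp
    next
      case False
      with m have N: "1 < card reps" by simp
      obtain i j where ij: "\<And>y. bary x y m = cdiff y i j - \<lfloor>cdiff x i j\<rfloor>"
        using bary_facet[OF x N m] by blast
      show ?thesis
        using cell by (simp add: ij cell_def)
    qed
  qed
next
  assume nonneg: "\<forall>m<card reps. 0 \<le> bary x y m"
  show "y \<in> cell x"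
  proof (rule flat_mem_cell[OF x y])
    fix i j assume ij: "i \<in> reps" "j \<in> reps" "i \<noteq> j"
    obtain M where M: "M \<subset> {..<card reps}"
      "\<And>y. cdiff y i j = \<lfloor>cdiff x i j\<rfloor> + (\<Sum>m\<in>M. bary x y m)"
      using cdiff_arc[OF x ij] by metis
    have "0 \<le> (\<Sum>m\<in>M. bary x y m)"
      using M(1) nonneg by (intro sum_nonneg) auto
    moreover have "(\<Sum>m\<in>M. bary x y m) \<le> (\<Sum>m<card reps. bary x y m)"
      using M(1) nonneg by (intro sum_mono2) auto
    ultimately show "\<lfloor>cdiff x i j\<rfloor> \<le> cdiff y i j \<and> cdiff y i j \<le> \<lfloor>cdiff x i j\<rfloor> + 1"
      using sum_bary[OF x, of y] M(2)[of y] by linarith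
  qed
qed

lemma sum_bary_strict:
  assumes x: "x \<in> generic" and M: "M \<subset> {..<card reps}" "M \<noteq> {}"
    and pos: "\<And>m. m < card reps \<Longrightarrow> 0 < bary x y m"
  shows "0 < (\<Sum>m\<in>M. bary x y m)" "(\<Sum>m\<in>M. bary x y m) < 1"
proof -
  have fin: "finite M" using M(1) finite_subset by blast
  show "0 < (\<Sum>m\<in>M. bary x y m)"
    using M pos fin by (intro sum_pos) auto
  obtain b where "b \<in> {..<card reps} - M" using M(1) by blast
  then have "(\<Sum>m\<in>M. bary x y m) < (\<Sum>m<card reps. bary x y m)"
    using M(1) pos by (intro sum_strict_mono2[of _ _ b]) (auto simp: less_imp_le)
  then show "(\<Sum>m\<in>M. bary x y m) < 1"
    using sum_bary[OF x, of y] by simp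
qed

lemma mem_region_iff:
  assumes x: "x \<in> generic" and y: "y \<in> flat"
  shows "y \<in> region x \<longleftrightarrow> (\<forall>m<card reps. 0 < bary x y m)"
proof
  assume "y \<in> region x"
  then have "y \<in> cell x" "y \<in> generic"
    using region_eq[OF generic_in_P[OF x]] by auto
  then show "\<forall>m<card reps. 0 < bary x y m"
    using mem_cell_iff[OF x y] bary_generic_nonzero[OF x, of y] by (auto simp: less_le)
next
  assume pos: "\<forall>m<card reps. 0 < bary x y m"
  then have cell: "y \<in> cell x"
    using mem_cell_iff[OF x y] by (simp add: less_imp_le)
  have "cdiff y i j \<notin> \<int>" if "\<not> tied i j" for i j
  proof -
    obtain c :: int where c: "\<And>y. y \<in> flat \<Longrightarrow> cdiff y i j = cdiff y (rep i) (rep j) + c"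
      using flat_cdiff_rep[OF generic_in_P[OF x]] by blast
    have "rep i \<noteq> rep j" using that rep_eq_iff by blast
    then obtain M where M: "M \<noteq> {}" "M \<subset> {..<card reps}"
      "\<And>y. cdiff y (rep i) (rep j) = \<lfloor>cdiff x (rep i) (rep j)\<rfloor> + (\<Sum>m\<in>M. bary x y m)"
      using cdiff_arc[OF x rep_in_reps rep_in_reps] by metis
    show ?thesis
      using sum_bary_strict[OF x M(2,1), of y] pos M(3)[of y] c[OF y]
      by (intro between_not_Ints[of "c + \<lfloor>cdiff x (rep i) (rep j)\<rfloor>"]) auto
  qed
  with cell have "y \<in> generic"
    using cell_subset by (auto simp: generic_def)
  with cell show "y \<in> region x"
    by (simp add: region_eq generic_in_P x)
qed

text \<open>Levels are partial sums of the weights and determine the coordinates at the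
  representatives. The conclusion on \<open>lev\<close> is what later turns integral weights into
  lattice points.\<close>

lemma ex_bary:
  assumes x: "x \<in> generic" and w: "(\<Sum>m<card reps. w m) = 1"
  obtains y where "y \<in> flat" "\<And>m. m < card reps \<Longrightarrow> bary x y m = w m"
    "\<And>m. m \<le> card reps \<Longrightarrow> lev x y m = (\<Sum>k<m. w k)"
proof -
  define g where "g = (\<lambda>i. \<lfloor>ext_coord x i\<rfloor> + (\<Sum>k<inv_into {..<card reps} (enum x) i. w k))"
  have inv: "inv_into {..<card reps} (enum x) (enum x a) = a" if "a < card reps" for a
    using that bij_enum[OF x] by (simp add: bij_betw_def inv_into_f_f)
  have "g None = 0"
    using inv[of 0] by (simp add: g_def enum_0[OF x])
  then obtain y where y: "y \<in> flat" "\<And>i. i \<in> reps \<Longrightarrow> ext_coord y i = g i"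
    using ex_flat_point[OF generic_in_P[OF x], of g] by auto
  have lev: "lev x y m = (\<Sum>k<m. w k)" if "m \<le> card reps" for m
  proof (cases "m < card reps")
    case True
    with y(2)[OF enum_in_reps[OF x True]] inv[OF True] show ?thesis
      by (simp add: lev_def g_def)
  next
    case False
    with that have "m = card reps" by simp
    with w show ?thesis by (simp add: lev_def)
  qed
  then have "bary x y m = w m" if "m < card reps" for m
    using that by (simp add: bary_def)
  with y(1) lev show ?thesis by (intro that) auto
qed

lemma bary_inject:
  assumes x: "x \<in> generic" and y: "y \<in> flat" and z: "z \<in> flat"
    and eq: "\<And>m. m < card reps \<Longrightarrow> bary x y m = bary x z m"
  shows "y = z"
proof -
  have coord: "ext_coord y i = ext_coord z i" if i: "i \<in> reps" for i
  proof -
    obtain a where a: "a < card reps" "i = enum x a"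
      using ex_enum_index[OF x i] by metis
    have "lev x y a = lev x z a"
      unfolding sum_bary_lessThan[OF x, symmetric] using a eq by (intro sum.cong) auto
    with a show ?thesis by (simp add: lev_def)
  qed
  have "ext_coord y i = ext_coord z i" for i
  proof -
    obtain c :: int where c: "\<And>y. y \<in> flat \<Longrightarrow> cdiff y i None = cdiff y (rep i) (rep None) + c"
      using flat_cdiff_rep[OF generic_in_P[OF x]] by blast
    show ?thesis using c[OF y] c[OF z] coord[of "rep i"] by simp
  qed
  from this[of "Some _"] show ?thesis
    by (simp add: vec_eq_iff)
qed

end

section \<open>Adjacent simplices and distance\<close>

lemma tendsto_toward:
  fixes a b :: real
  shows "((\<lambda>e. a + e * (b - a)) \<longlongrightarrow> a) (at_right 0)"
proof -
  have "((\<lambda>e. a + e * (b - a)) \<longlongrightarrow> a + 0 * (b - a)) (at_right 0)"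
    by (intro tendsto_intros)
  then show ?thesis by simp
qed

lemma eventually_at_right_0:
  "\<forall>\<^sub>F e in at_right (0::real). 0 < e \<and> e < 1"
  using eventually_at_right_less[of "0::real"] eventually_at_right_real[of 0 "1::real", simplified]
  by eventually_elim auto

text \<open>Only a decreasing motion that starts at an integer drops the floor immediately;
  \<open>\<lceil>a\<rceil> - 1\<close> covers both integral and non-integral starting
  points.\<close>

lemma eventually_floor_toward:
  fixes a b :: real
  shows "\<forall>\<^sub>F e in at_right 0. \<lfloor>a + e * (b - a)\<rfloor> = (if b < a then \<lceil>a\<rceil> - 1 else \<lfloor>a\<rfloor>)"
proof (cases "b < a")
  case True
  have "\<forall>\<^sub>F e in at_right 0. of_int (\<lceil>a\<rceil> - 1) < a + e * (b - a)"
    by (rule order_tendstoD[OF tendsto_toward]) (use ceiling_correct[of a] in simp)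
  with eventually_at_right_0 show ?thesis
  proof eventually_elim
    case (elim e)
    then have "e * (b - a) < 0" using True by (simp add: mult_less_0_iff)
    then have "a + e * (b - a) < of_int \<lceil>a\<rceil>" using le_of_int_ceiling[of a] by linarith
    with elim have "\<lfloor>a + e * (b - a)\<rfloor> = \<lceil>a\<rceil> - 1"
      by (intro floor_unique) auto
    with True show ?case by simp
  qed
next
  case False
  have "\<forall>\<^sub>F e in at_right 0. a + e * (b - a) < of_int \<lfloor>a\<rfloor> + 1"
    by (rule order_tendstoD[OF tendsto_toward]) (use floor_correct[of a] in simp)
  with eventually_at_right_0 show ?thesis
  proof eventually_elim
    case (elim e)
    then have "0 \<le> e * (b - a)" using False by simp
    then have "of_int \<lfloor>a\<rfloor> \<le> a + e * (b - a)" using of_int_floor_le[of a] by linarith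
    with elim have "\<lfloor>a + e * (b - a)\<rfloor> = \<lfloor>a\<rfloor>"
      by (intro floor_unique) auto
    with False show ?case by simp
  qed
qed

lemma eventually_toward_not_Ints:
  fixes a b :: real
  assumes "b \<notin> \<int>"
  shows "\<forall>\<^sub>F e in at_right 0. a + e * (b - a) \<notin> \<int>"
proof -
  consider "b = a" | "b < a" | "a < b" by linarith
  then show ?thesis
  proof cases
    case 1
    with assms show ?thesis by simp
  next
    case 2
    have "\<forall>\<^sub>F e in at_right 0. of_int (\<lceil>a\<rceil> - 1) < a + e * (b - a)"
      by (rule order_tendstoD[OF tendsto_toward]) (use ceiling_correct[of a] in simp)
    with eventually_at_right_0 show ?thesis
    proof eventually_elim
      case (elim e)
      then have "e * (b - a) < 0" using 2 by (simp add: mult_less_0_iff)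
      then have "a + e * (b - a) < of_int \<lceil>a\<rceil>" using le_of_int_ceiling[of a] by linarith
      with elim show ?case
        by (intro between_not_Ints[of "\<lceil>a\<rceil> - 1"]) auto
    qed
  next
    case 3
    have "\<forall>\<^sub>F e in at_right 0. a + e * (b - a) < of_int \<lfloor>a\<rfloor> + 1"
      by (rule order_tendstoD[OF tendsto_toward]) (use floor_correct[of a] in simp)
    with eventually_at_right_0 show ?thesis
    proof eventually_elim
      case (elim e)
      then have "0 < e * (b - a)" using 3 by simp
      then have "of_int \<lfloor>a\<rfloor> < a + e * (b - a)" using of_int_floor_le[of a] by linarith
      with elim show ?case
        by (intro between_not_Ints) auto
    qed
  qed
qed

context alcoved_body
begin

lemma eventually_toward_generic:
  assumes q: "q \<in> generic" and y: "y \<in> P"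
  shows "\<forall>\<^sub>F e in at_right 0. y + e *\<^sub>R (q - y) \<in> generic"
proof -
  have "\<forall>\<^sub>F e in at_right 0. \<forall>i j. \<not> tied i j \<longrightarrow> cdiff (y + e *\<^sub>R (q - y)) i j \<notin> \<int>"
  proof (intro eventually_all_finite)
    fix i j
    show "\<forall>\<^sub>F e in at_right 0. \<not> tied i j \<longrightarrow> cdiff (y + e *\<^sub>R (q - y)) i j \<notin> \<int>"
    proof (cases "tied i j")
      case False
      with eventually_toward_not_Ints[OF genericD[OF q False]] show ?thesis
        by (simp add: cdiff_toward)
    qed simp
  qed
  with eventually_at_right_0 show ?thesis
  proof eventually_elim
    case (elim e)
    then have "y + e *\<^sub>R (q - y) \<in> P"
      using toward_in_convex[OF convex y generic_in_P[OF q], of e] by simp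
    with elim show ?case by (simp add: generic_def)
  qed
qed

text \<open>All finitely many floors become constant for small \<open>e\<close>, so the moving point
  stays in one region. This is the covering half of the partition into half-open simplices.\<close>

lemma ex_region_toward:
  assumes q: "q \<in> generic" and y: "y \<in> P"
  obtains x where "x \<in> generic" "\<forall>\<^sub>F e in at_right 0. y + e *\<^sub>R (q - y) \<in> region x"
proof -
  define f where "f = (\<lambda>i j. if cdiff q i j < cdiff y i j then \<lceil>cdiff y i j\<rceil> - 1 else \<lfloor>cdiff y i j\<rfloor>)"
  have "\<forall>\<^sub>F e in at_right 0. \<forall>i j. \<lfloor>cdiff (y + e *\<^sub>R (q - y)) i j\<rfloor> = f i j"
    unfolding cdiff_toward f_def by (intro eventually_all_finite eventually_floor_toward)
  with eventually_toward_generic[OF q y]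
  have ev: "\<forall>\<^sub>F e in at_right 0. y + e *\<^sub>R (q - y) \<in> generic \<and>
      (\<forall>i j. \<lfloor>cdiff (y + e *\<^sub>R (q - y)) i j\<rfloor> = f i j)"
    by eventually_elim auto
  then obtain e where e: "y + e *\<^sub>R (q - y) \<in> generic"
      "\<And>i j. \<lfloor>cdiff (y + e *\<^sub>R (q - y)) i j\<rfloor> = f i j"
    using eventually_happens'[OF trivial_limit_at_right_real] by blast
  from ev have "\<forall>\<^sub>F e' in at_right 0. y + e' *\<^sub>R (q - y) \<in> region (y + e *\<^sub>R (q - y))"
    by eventually_elim (simp add: region_def e(2))
  with e(1) show ?thesis by (rule that)
qed

text \<open>The facets, indexed by the opposite barycentric coordinate, whose hyperplane separates
  the simplex around \<open>x\<close> from \<open>q\<close>.\<close>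

definition visible :: "real ^ 'n \<Rightarrow> real ^ 'n \<Rightarrow> nat set" where
  "visible q x = {m. m < card reps \<and> bary x q m < 0}"

text \<open>Along the motion each barycentric coordinate is affine in \<open>e\<close>: it is
  positive for small \<open>e\<close> iff it starts positive, or starts at 0 and is positive at
  \<open>q\<close>. Genericity of \<open>q\<close> rules out the value 0 there.\<close>

lemma eventually_region_iff:
  assumes q: "q \<in> generic" and x: "x \<in> generic" and y: "y \<in> flat"
  shows "(\<forall>\<^sub>F e in at_right 0. y + e *\<^sub>R (q - y) \<in> region x) \<longleftrightarrow>
    y \<in> cell x \<and> (\<forall>m\<in>visible q x. 0 < bary x y m)"
proof -
  have flat: "y + e *\<^sub>R (q - y) \<in> flat" for e
    using affine_toward[OF affine_flat y generic_in_flat[OF q]] .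
  have iff: "y + e *\<^sub>R (q - y) \<in> region x \<longleftrightarrow>
      (\<forall>m<card reps. 0 < bary x y m + e * (bary x q m - bary x y m))" for e
    by (simp add: mem_region_iff[OF x flat] bary_toward[OF x])
  show ?thesis
  proof
    assume ev: "\<forall>\<^sub>F e in at_right 0. y + e *\<^sub>R (q - y) \<in> region x"
    have nonneg: "0 \<le> bary x y m" if "m < card reps" for m
    proof (rule tendsto_lowerbound[OF tendsto_toward[of _ "bary x q m"]])
      show "\<forall>\<^sub>F e in at_right 0. 0 \<le> bary x y m + e * (bary x q m - bary x y m)"
        using ev by eventually_elim (use that in \<open>auto simp: iff less_imp_le\<close>)
    qed simp
    have "bary x y m \<noteq> 0" if m: "m \<in> visible q x" for m
    proof
      assume 0: "bary x y m = 0"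
      have "\<forall>\<^sub>F e in at_right (0::real). False"
        using ev eventually_at_right_0
      proof eventually_elim
        case (elim e)
        then have "0 < e * bary x q m" using m 0 by (auto simp: iff visible_def)
        with elim m show False by (simp add: visible_def zero_less_mult_iff)
      qed
      then show False by simp
    qed
    with nonneg show "y \<in> cell x \<and> (\<forall>m\<in>visible q x. 0 < bary x y m)"
      by (force simp: mem_cell_iff[OF x y] visible_def less_le)
  next
    assume asm: "y \<in> cell x \<and> (\<forall>m\<in>visible q x. 0 < bary x y m)"
    have "\<forall>\<^sub>F e in at_right 0. \<forall>m\<in>{..<card reps}. 0 < bary x y m + e * (bary x q m - bary x y m)"
    proof (intro eventually_ball_finite ballI)
      fix m assume "m \<in> {..<card reps}"
      then have m: "m < card reps" by simp
      show "\<forall>\<^sub>F e in at_right 0. 0 < bary x y m + e * (bary x q m - bary x y m)"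
      proof (cases "bary x y m = 0")
        case True
        with asm have "m \<notin> visible q x" by fastforce
        with m bary_generic_nonzero[OF x q m] have "0 < bary x q m"
          by (simp add: visible_def)
        with True show ?thesis
          by (intro eventually_mono[OF eventually_at_right_0]) simp
      next
        case False
        with asm m have "0 < bary x y m"
          by (auto simp: mem_cell_iff[OF x y] less_le)
        then show ?thesis by (rule order_tendstoD[OF tendsto_toward])
      qed
    qed simp
    then show "\<forall>\<^sub>F e in at_right 0. y + e *\<^sub>R (q - y) \<in> region x"
      by eventually_elim (simp add: iff)
  qed
qed

lemma bary_inner:
  obtains a b where "\<And>y. bary x y m = a \<bullet> y - b"
proof -
  have ext: "ext_coord y i = ext_axis i \<bullet> y" for y :: "real ^ 'n" and i
    using cdiff_inner[of y i None] by (simp add: ext_axis_def)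
  have "\<exists>a b. \<forall>y. lev x y k = a \<bullet> y - b" for k
  proof (cases "k < card reps")
    case True
    then show ?thesis unfolding lev_def ext by auto
  next
    case False
    then show ?thesis
      unfolding lev_def by (intro exI[of _ 0] exI[of _ "-1"]) simp
  qed
  then obtain a b a' b' where "\<And>y. lev x y (Suc m) = a \<bullet> y - b" "\<And>y. lev x y m = a' \<bullet> y - b'"
    by metis
  then have "bary x y m = (a - a') \<bullet> y - (b - b')" for y
    by (simp add: bary_def inner_diff_left)
  then show ?thesis by (rule that)
qed

lemma continuous_on_bary: "continuous_on S (\<lambda>y. bary x y m)"
proof -
  obtain a b where "\<And>y. bary x y m = a \<bullet> y - b"
    using bary_inner[of x m] by blast
  then show ?thesis by (simp add: continuous_intros)
qed

section \<open>Neighbouring simplices\<close>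

lemma floor_cdiff_swap:
  assumes "x \<in> generic" "i \<in> reps" "j \<in> reps" "i \<noteq> j"
  shows "\<lfloor>cdiff x j i\<rfloor> = - \<lfloor>cdiff x i j\<rfloor> - 1"
proof -
  have "cdiff x i j \<noteq> of_int \<lfloor>cdiff x i j\<rfloor>"
    using genericD[OF assms(1) reps_untied[OF assms(2-4)]] by (metis Ints_of_int)
  then have "\<lfloor>cdiff x i j\<rfloor> < cdiff x i j" "cdiff x i j < \<lfloor>cdiff x i j\<rfloor> + 1"
    by linarith+
  then show ?thesis
    unfolding cdiff_swap[of x j i]
    by (intro floor_unique; simp only: of_int_diff of_int_minus of_int_1; linarith)
qed

lemma cell_eq_if_reps:
  assumes x: "x \<in> generic" and y: "y \<in> generic"
    and eq: "\<And>i j. i \<in> reps \<Longrightarrow> j \<in> reps \<Longrightarrow> i \<noteq> j \<Longrightarrow> \<lfloor>cdiff x i j\<rfloor> = \<lfloor>cdiff y i j\<rfloor>"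
  shows "cell x = cell y"
proof (rule cell_cong)
  fix i j
  obtain c :: int where c: "\<And>y. y \<in> flat \<Longrightarrow> cdiff y i j = cdiff y (rep i) (rep j) + c"
    using flat_cdiff_rep[OF generic_in_P[OF x]] by blast
  show "\<lfloor>cdiff x i j\<rfloor> = \<lfloor>cdiff y i j\<rfloor>"
    using c[OF generic_in_flat[OF x]] c[OF generic_in_flat[OF y]] eq[of "rep i" "rep j"]
    by (cases "rep i = rep j") simp_all
qed

text \<open>A pair with different floors forces the common facet onto one hyperplane. Dimension
  makes \<open>flat \<inter> H\<close> the affine hull of the facet, which leaves no room for a
  second pair.\<close>

lemma adjacent_floors:
  assumes x: "x \<in> generic" and x': "x' \<in> generic"
    and fac: "(cell x \<inter> cell x') facet_of cell x"
  obtains i j where "i \<in> reps" "j \<in> reps" "i \<noteq> j" "\<lfloor>cdiff x' i j\<rfloor> = \<lfloor>cdiff x i j\<rfloor> + 1"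
    "\<And>k l. k \<in> reps \<Longrightarrow> l \<in> reps \<Longrightarrow> k \<noteq> l \<Longrightarrow> {k, l} \<noteq> {i, j} \<Longrightarrow>
      \<lfloor>cdiff x k l\<rfloor> = \<lfloor>cdiff x' k l\<rfloor>"
proof -
  define G where "G = cell x \<inter> cell x'"
  have G: "G \<noteq> {}" "aff_dim G = aff_dim flat - 1"
    using fac aff_dim_cell[OF x] by (auto simp: facet_of_def G_def)
  have "cell x \<noteq> cell x'"
    using fac by auto
  then obtain i0 j0 where 0: "i0 \<in> reps" "j0 \<in> reps" "i0 \<noteq> j0" "\<lfloor>cdiff x i0 j0\<rfloor> \<noteq> \<lfloor>cdiff x' i0 j0\<rfloor>"
    using cell_eq_if_reps[OF x x'] by blast
  obtain i j where ij: "i \<in> reps" "j \<in> reps" "i \<noteq> j" "\<lfloor>cdiff x i j\<rfloor> < \<lfloor>cdiff x' i j\<rfloor>"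
  proof (cases "\<lfloor>cdiff x i0 j0\<rfloor> < \<lfloor>cdiff x' i0 j0\<rfloor>")
    case True
    with 0 that show ?thesis by blast
  next
    case False
    then have "\<lfloor>cdiff x j0 i0\<rfloor> < \<lfloor>cdiff x' j0 i0\<rfloor>"
      using 0 floor_cdiff_swap[OF x 0(1-3)] floor_cdiff_swap[OF x' 0(1-3)] by linarith
    with 0 that show ?thesis by metis
  qed
  have gap: "cdiff y k l = of_int \<lfloor>cdiff z' k l\<rfloor> \<and> \<lfloor>cdiff z' k l\<rfloor> = \<lfloor>cdiff z k l\<rfloor> + 1"
    if "y \<in> cell z" "y \<in> cell z'" "\<lfloor>cdiff z k l\<rfloor> < \<lfloor>cdiff z' k l\<rfloor>" for y z z' k l
  proof -
    have 1: "of_int \<lfloor>cdiff z' k l\<rfloor> \<le> cdiff y k l" "cdiff y k l \<le> of_int (\<lfloor>cdiff z k l\<rfloor> + 1)"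
      using that(1,2) by (auto simp: cell_def)
    then have "real_of_int \<lfloor>cdiff z' k l\<rfloor> \<le> of_int (\<lfloor>cdiff z k l\<rfloor> + 1)" by linarith
    then have "\<lfloor>cdiff z' k l\<rfloor> \<le> \<lfloor>cdiff z k l\<rfloor> + 1" by (simp only: of_int_le_iff)
    with that(3) have "\<lfloor>cdiff z' k l\<rfloor> = \<lfloor>cdiff z k l\<rfloor> + 1" by simp
    with 1 show ?thesis by simp
  qed
  obtain y where y: "y \<in> cell x" "y \<in> cell x'" using G by (auto simp: G_def)
  have yf: "y \<in> flat" using y cell_subset P_subset_flat by blast
  have xP: "x \<in> P" by (rule generic_in_P[OF x])
  have step: "\<lfloor>cdiff x' i j\<rfloor> = \<lfloor>cdiff x i j\<rfloor> + 1"
    using gap[OF y ij(4)] by simp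
  define H where "H = {z. (ext_axis i - ext_axis j) \<bullet> z = of_int \<lfloor>cdiff x' i j\<rfloor>}"
  have H: "z \<in> H \<longleftrightarrow> cdiff z i j = of_int \<lfloor>cdiff x' i j\<rfloor>" for z
    by (simp add: H_def cdiff_inner)
  have GH: "G \<subseteq> flat \<inter> H"
    using gap[OF _ _ ij(4)] cell_subset P_subset_flat by (auto simp: G_def H)
  have affH: "affine (flat \<inter> H)"
    unfolding H_def by (intro affine_Int affine_flat affine_hyperplane)
  have "x \<in> flat - H"
    using generic_in_flat[OF x] genericD[OF x reps_untied[OF ij(1-3)]] by (auto simp: H)
  then have "aff_dim (flat \<inter> H) = aff_dim flat - 1"
    using aff_dim_affine_Int_hyperplane[OF affine_flat, of "ext_axis i - ext_axis j"] G(1) GH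
    unfolding H_def by (auto split: if_splits)
  then have hull: "affine hull G = flat \<inter> H"
    using G GH affH by (intro affine_dim_equal affine_affine_hull hull_minimal) auto
  have "\<lfloor>cdiff x k l\<rfloor> = \<lfloor>cdiff x' k l\<rfloor>"
    if kl: "k \<in> reps" "l \<in> reps" "k \<noteq> l" "{k, l} \<noteq> {i, j}" for k l
  proof (rule ccontr)
    assume ne: "\<lfloor>cdiff x k l\<rfloor> \<noteq> \<lfloor>cdiff x' k l\<rfloor>"
    have const: "cdiff z k l = cdiff y k l" if "z \<in> G" for z
    proof (cases "\<lfloor>cdiff x k l\<rfloor> < \<lfloor>cdiff x' k l\<rfloor>")
      case True
      with gap[of _ x x' k l] that y show ?thesis by (simp add: G_def)
    next
      case False
      with ne gap[of _ x' x k l] that y show ?thesis by (simp add: G_def)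
    qed
    have "affine hull G \<subseteq> {z. (ext_axis k - ext_axis l) \<bullet> z = cdiff y k l}"
      by (rule hull_minimal) (use const in \<open>auto simp: cdiff_inner affine_hyperplane\<close>)
    then have all: "cdiff z k l = cdiff y k l" if "z \<in> flat" "z \<in> H" for z
      using that hull by (auto simp: cdiff_inner)
    \<comment> \<open>Raising only the coordinate of an index outside \<open>{i, j}\<close> keeps
      the point on \<open>H\<close> but changes the other difference. The index may be
      \<open>None\<close>, which is why the point is prescribed only up to normalisation.\<close>
    obtain k0 where k0: "k0 \<in> {k, l}" "k0 \<notin> {i, j}"
      using kl ij(3) by blast
    define g where "g = (ext_coord y)(k0 := ext_coord y k0 + 1)"
    obtain z where z: "z \<in> flat" "\<And>i. i \<in> reps \<Longrightarrow> ext_coord z i = g i - g None"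
      using ex_flat_point[OF xP, of g] by blast
    have "cdiff z i j = cdiff y i j"
      using z(2)[OF ij(1)] z(2)[OF ij(2)] k0 by (auto simp: cdiff_def g_def)
    with gap[OF y ij(4)] z(1) have "cdiff z k l = cdiff y k l"
      by (intro all) (simp_all add: H)
    moreover have "cdiff z k l = g k - g l"
      using z(2)[OF kl(1)] z(2)[OF kl(2)] by (simp add: cdiff_def)
    ultimately show False
      using k0(1) kl(3) by (auto simp: g_def cdiff_def)
  qed
  with ij step show ?thesis by (intro that) auto
qed


abbreviation adjacency :: "((real ^ 'n) set \<times> (real ^ 'n) set) set" where
  "adjacency \<equiv> dual_graph (cell ` generic)"

lemma card_reps_gt_1:
  assumes "x \<in> generic" "m \<in> visible q x"
  shows "1 < card reps"
proof (rule ccontr)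
  assume "\<not> 1 < card reps"
  with card_reps_pos have "card reps = 1" by linarith
  with assms bary_point[of x q] show False by (auto simp: visible_def)
qed

text \<open>The witness is the barycentre of the facet opposite to vertex \<open>m\<close>.\<close>

lemma ex_facet_point:
  assumes x: "x \<in> generic" and N: "1 < card reps" and m: "m < card reps"
  obtains f where "f \<in> flat" "bary x f m = 0" "\<And>k. k < card reps \<Longrightarrow> k \<noteq> m \<Longrightarrow> 0 < bary x f k"
proof -
  define w where "w = (\<lambda>k. if k = m then 0 else 1 / (real (card reps) - 1))"
  have "(\<Sum>k<card reps. w k) = (\<Sum>k\<in>{..<card reps} - {m}. w k)"
    using m by (intro sum.mono_neutral_right) (auto simp: w_def)
  also have "\<dots> = (\<Sum>k\<in>{..<card reps} - {m}. 1 / (real (card reps) - 1))"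
    by (rule sum.cong) (auto simp: w_def)
  also have "\<dots> = 1"
    using N m by (simp add: of_nat_diff)
  finally have w: "(\<Sum>k<card reps. w k) = 1" .
  obtain f where "f \<in> flat" "\<And>k. k < card reps \<Longrightarrow> bary x f k = w k"
    using ex_bary[OF x w] by metis
  with N m show ?thesis
    by (intro that[of f]) (auto simp: w_def)
qed

text \<open>A hyperplane of the arrangement that meets the relative interior of a facet contains the
  whole facet.\<close>

lemma facet_arc:
  assumes x: "x \<in> generic" and m: "m < card reps"
    and f: "bary x f m = 0" "\<And>k. k < card reps \<Longrightarrow> k \<noteq> m \<Longrightarrow> 0 < bary x f k"
    and ij: "i \<in> reps" "j \<in> reps" "i \<noteq> j"
  shows "(\<forall>y. bary x y m = 0 \<longrightarrow> cdiff y i j = cdiff f i j) \<or>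
    (of_int \<lfloor>cdiff x i j\<rfloor> < cdiff f i j \<and> cdiff f i j < of_int \<lfloor>cdiff x i j\<rfloor> + 1)"
proof -
  obtain M where M: "M \<noteq> {}" "M \<subset> {..<card reps}"
    "\<And>y. cdiff y i j = \<lfloor>cdiff x i j\<rfloor> + (\<Sum>k\<in>M. bary x y k)"
    using cdiff_arc[OF x ij] by metis
  have fin: "finite M" using M(2) finite_subset by blast
  have nonneg: "0 \<le> bary x f k" if "k < card reps" for k
    using f that by (cases "k = m") (auto simp: less_imp_le)
  have "M = {m}" if "\<forall>k\<in>M. k = m"
    using that M(1) by auto
  moreover have "M = {..<card reps} - {m}" if *: "\<forall>k\<in>{..<card reps} - M. k = m"
  proof -
    have "\<exists>b. b \<in> {..<card reps} - M" using M(2) by auto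
    with * have "m \<notin> M" by auto
    with * M(2) show ?thesis by auto
  qed
  \<comment> \<open>On the facet coordinate \<open>m\<close> vanishes. The first two arcs have
    constant sum 0 or 1 there; any other arc has a positive coordinate both inside and outside, so
    its sum at \<open>f\<close> is strictly between.\<close>
  ultimately consider "M = {m}" | "M = {..<card reps} - {m}" |
    (mid) k k' where "k \<in> M" "k \<noteq> m" "k' \<in> {..<card reps} - M" "k' \<noteq> m"
    by metis
  then show ?thesis
  proof cases
    case 1
    have "cdiff y i j = cdiff f i j" if "bary x y m = 0" for y
      using M(3)[of y] M(3)[of f] f(1) that 1 by simp
    then show ?thesis by blast
  next
    case 2
    have "(\<Sum>k\<in>M. bary x y k) = 1 - bary x y m" for y
      using sum_bary[OF x, of y] m unfolding 2 by (subst sum_diff1) auto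
    then have "cdiff y i j = cdiff f i j" if "bary x y m = 0" for y
      using M(3)[of y] M(3)[of f] f(1) that by simp
    then show ?thesis by blast
  next
    case mid
    have "0 < (\<Sum>k\<in>M. bary x f k)"
      using mid M(2) f(2) nonneg fin by (intro sum_pos2[of M k]) auto
    moreover have "(\<Sum>k\<in>M. bary x f k) < (\<Sum>k<card reps. bary x f k)"
      using mid M(2) f(2) nonneg by (intro sum_strict_mono2[of _ _ k']) auto
    ultimately show ?thesis
      using M(3)[of f] sum_bary[OF x, of f] by linarith
  qed
qed

text \<open>Shows that the sign of a barycentric coordinate depends only on the region of
  \<open>z\<close>, so it may be tested at any point of that region.\<close>

lemma bary_neg_iff_floor:
  fixes i j :: "'n option"
  assumes "\<And>y. bary x y m = cdiff y i j - \<lfloor>cdiff x i j\<rfloor>"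
  shows "bary x z m < 0 \<longleftrightarrow> \<lfloor>cdiff z i j\<rfloor> < \<lfloor>cdiff x i j\<rfloor>"
  by (simp add: assms floor_less_iff)

text \<open>Starting in the relative interior of the visible facet and moving slightly toward
  \<open>q\<close> leaves the simplex through this facet alone; \<open>x'\<close> represents the
  region entered.\<close>

lemma ex_neighbour:
  assumes q: "q \<in> generic" and x: "x \<in> generic" and mv: "m \<in> visible q x"
  obtains x' where "x' \<in> generic" "(cell x', cell x) \<in> adjacency"
    "bary x x' m < 0" "\<And>k. k < card reps \<Longrightarrow> k \<noteq> m \<Longrightarrow> 0 < bary x x' k"
proof -
  have N: "1 < card reps" by (rule card_reps_gt_1[OF x mv])
  have m: "m < card reps" and mq: "bary x q m < 0" using mv by (auto simp: visible_def)
  obtain f where f: "f \<in> flat" "bary x f m = 0" "\<And>k. k < card reps \<Longrightarrow> k \<noteq> m \<Longrightarrow> 0 < bary x f k"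
    using ex_facet_point[OF x N m] by blast
  have "f \<in> cell x"
    using f by (simp add: mem_cell_iff[OF x f(1)]) (metis less_imp_le order_refl)
  then have fP: "f \<in> P" using cell_subset by blast
  obtain x' where x': "x' \<in> generic" and ev: "\<forall>\<^sub>F e in at_right 0. f + e *\<^sub>R (q - f) \<in> region x'"
    using ex_region_toward[OF q fP] by blast
  have fx': "f \<in> cell x'"
    using ev eventually_region_iff[OF q x' f(1)] by blast
  have same_sign: "bary x z k < 0 \<longleftrightarrow> bary x x' k < 0" if zk: "z \<in> region x'" "k < card reps" for z k
  proof -
    obtain i j where "\<And>y. bary x y k = cdiff y i j - \<lfloor>cdiff x i j\<rfloor>"
      using bary_facet[OF x N zk(2)] by blast
    from bary_neg_iff_floor[OF this] zk(1) show ?thesis by (simp add: region_def)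
  qed
  have ev_sign: "\<forall>\<^sub>F e in at_right 0. bary x x' k < 0 \<longleftrightarrow> bary x f k + e * (bary x q k - bary x f k) < 0"
    if "k < card reps" for k
    using ev by eventually_elim (use same_sign that bary_toward[OF x that] in metis)
  have neg: "bary x x' m < 0"
  proof -
    have "\<forall>\<^sub>F e in at_right (0::real). bary x x' m < 0"
      using ev_sign[OF m] eventually_at_right_0
      by eventually_elim (use f(2) mq in \<open>simp add: mult_less_0_iff\<close>)
    then show ?thesis by simp
  qed
  have pos: "0 < bary x x' k" if "k < card reps" "k \<noteq> m" for k
  proof -
    have "\<forall>\<^sub>F e in at_right 0. 0 < bary x f k + e * (bary x q k - bary x f k)"
      by (rule order_tendstoD[OF tendsto_toward f(3)[OF that]])
    then have "\<forall>\<^sub>F e in at_right (0::real). \<not> bary x x' k < 0"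
      using ev_sign[OF that(1)] by eventually_elim simp
    then have "\<not> bary x x' k < 0" by simp
    with bary_generic_nonzero[OF x x' that(1)] show ?thesis by simp
  qed
  \<comment> \<open>By \<open>facet_arc\<close> each difference is either constant on the wall,
    hence within the bounds of both cells at \<open>f\<close>, or has the same floor at
    \<open>x\<close> and \<open>x'\<close>. So both cells have the same trace on the wall.\<close>
  have wall: "y \<in> cell x \<longleftrightarrow> y \<in> cell x'" if y: "y \<in> flat" "bary x y m = 0" for y
  proof -
    have bounds: "(of_int \<lfloor>cdiff z i j\<rfloor> \<le> cdiff y i j \<and> cdiff y i j \<le> of_int \<lfloor>cdiff z i j\<rfloor> + 1)"
      if "i \<in> reps" "j \<in> reps" "i \<noteq> j" "y \<in> cell z'" "z \<in> {x, x'}" "z' \<in> {x, x'}" for i j z z'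
      using facet_arc[OF x m f(2,3) that(1-3)]
    proof
      assume "\<forall>y. bary x y m = 0 \<longrightarrow> cdiff y i j = cdiff f i j"
      with y(2) have "cdiff y i j = cdiff f i j" by blast
      with \<open>f \<in> cell x\<close> fx' that(5) show ?thesis by (auto simp: cell_def)
    next
      assume *: "of_int \<lfloor>cdiff x i j\<rfloor> < cdiff f i j \<and> cdiff f i j < of_int \<lfloor>cdiff x i j\<rfloor> + 1"
      have "of_int \<lfloor>cdiff x' i j\<rfloor> \<le> cdiff f i j" "cdiff f i j \<le> of_int \<lfloor>cdiff x' i j\<rfloor> + 1"
        using fx' by (auto simp: cell_def)
      with * have "\<lfloor>cdiff x' i j\<rfloor> = \<lfloor>cdiff x i j\<rfloor>" by linarith
      with that(5,6) have "\<lfloor>cdiff z i j\<rfloor> = \<lfloor>cdiff z' i j\<rfloor>" by auto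
      with that(4) show ?thesis by (simp add: cell_def)
    qed
    show ?thesis
    proof
      assume "y \<in> cell x"
      with bounds[of _ _ x x'] show "y \<in> cell x'"
        by (intro flat_mem_cell[OF x' y(1)]) simp
    next
      assume "y \<in> cell x'"
      with bounds[of _ _ x' x] show "y \<in> cell x"
        by (intro flat_mem_cell[OF x y(1)]) simp
    qed
  qed
  obtain i j where ij: "\<And>y. bary x y m = cdiff y i j - \<lfloor>cdiff x i j\<rfloor>"
    using bary_facet[OF x N m] by blast
  have x'_le: "bary x y m \<le> 0" if "y \<in> cell x'" for y
  proof -
    have "\<lfloor>cdiff x' i j\<rfloor> < \<lfloor>cdiff x i j\<rfloor>" using neg bary_neg_iff_floor[OF ij] by blast
    then have "real_of_int (\<lfloor>cdiff x' i j\<rfloor> + 1) \<le> of_int \<lfloor>cdiff x i j\<rfloor>"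
      by (subst of_int_le_iff) simp
    moreover have "cdiff y i j \<le> of_int (\<lfloor>cdiff x' i j\<rfloor> + 1)"
      using that by (simp add: cell_def)
    ultimately show ?thesis by (simp add: ij)
  qed
  have cell_flat: "cell z \<subseteq> flat" for z
    using cell_subset P_subset_flat by blast
  obtain a b where ab: "\<And>y. bary x y m = a \<bullet> y - b"
    using bary_inner[of x m] by blast
  define H where "H = {y. a \<bullet> y = b}"
  have H: "y \<in> H \<longleftrightarrow> bary x y m = 0" for y
    by (simp add: H_def ab)
  have x_ge: "0 \<le> bary x y m" if "y \<in> cell x" for y
    using mem_cell_iff[OF x] that cell_flat m by blast
  have G1: "cell x \<inter> cell x' = cell x \<inter> H"
    using wall x'_le x_ge cell_flat unfolding set_eq_iff Int_iff H by (meson order_antisym subsetD)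
  have G2: "cell x \<inter> cell x' = cell x' \<inter> H"
    using wall x'_le x_ge cell_flat unfolding set_eq_iff Int_iff H by (meson order_antisym subsetD)
  have face1: "(cell x \<inter> cell x') face_of cell x"
    unfolding G1 H_def using x_ge ab
    by (intro face_of_Int_supporting_hyperplane_ge convex_cell) simp
  have face2: "(cell x \<inter> cell x') face_of cell x'"
    unfolding G2 H_def using x'_le ab
    by (intro face_of_Int_supporting_hyperplane_le convex_cell) simp
  \<comment> \<open>Within \<open>flat \<inter> H\<close>, positivity of the other coordinates is an
    open condition that holds at \<open>f\<close> and implies membership in both cells, so the
    intersection has codimension 1.\<close>
  define U where "U = (\<Inter>k\<in>{..<card reps} - {m}. {y. 0 < bary x y k})"
  have "open U"
    unfolding U_def
    by (intro open_INT finite_Diff finite_lessThan ballI open_Collect_less continuous_on_const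
        continuous_on_bary)
  have fU: "f \<in> U" "f \<in> H" using f by (auto simp: U_def H)
  have sub: "flat \<inter> H \<inter> U \<subseteq> cell x \<inter> cell x'"
  proof
    fix y assume y: "y \<in> flat \<inter> H \<inter> U"
    then have "0 \<le> bary x y k" if "k < card reps" for k
      using that by (cases "k = m") (auto simp: U_def H less_imp_le)
    with y have "y \<in> cell x" by (simp add: mem_cell_iff[OF x])
    with y G1 show "y \<in> cell x \<inter> cell x'" by blast
  qed
  have affH: "affine (flat \<inter> H)"
    unfolding H_def by (intro affine_Int affine_flat affine_hyperplane)
  have "aff_dim (flat \<inter> H \<inter> U) = aff_dim (flat \<inter> H)"
    using \<open>open U\<close> fU f(1) by (intro aff_dim_openin affH) (auto simp: openin_open)
  moreover have "aff_dim (cell x \<inter> cell x') \<le> aff_dim (flat \<inter> H)"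
    using G1 cell_flat by (intro aff_dim_subset) blast
  moreover have "aff_dim (flat \<inter> H \<inter> U) \<le> aff_dim (cell x \<inter> cell x')"
    using sub by (rule aff_dim_subset)
  moreover have "aff_dim (flat \<inter> H) = aff_dim flat - 1"
  proof -
    have "x' \<notin> H" using neg by (simp add: H)
    then show ?thesis
      using aff_dim_affine_Int_hyperplane[OF affine_flat, of a b] generic_in_flat[OF x'] fU f(1)
      unfolding H_def by (auto split: if_splits)
  qed
  ultimately have dim: "aff_dim (cell x \<inter> cell x') = aff_dim flat - 1" by linarith
  have "cell x \<inter> cell x' \<noteq> {}" using \<open>f \<in> cell x\<close> fx' by blast
  with face1 face2 dim have "(cell x', cell x) \<in> adjacency"
    using x x' by (simp add: dual_graph_def facet_of_def aff_dim_cell Int_commute)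
  with x' neg pos show ?thesis by (intro that) auto
qed

lemma adjacent_bary_neg:
  assumes x: "x \<in> generic" and x': "x' \<in> generic" and adj: "(cell x', cell x) \<in> adjacency"
  obtains m where "m < card reps" "bary x x' m < 0"
proof -
  have "cell x \<noteq> cell x'" using adj by (auto simp: dual_graph_def)
  then have "x' \<notin> region x"
    using cell_cong[of x' x] by (auto simp: region_def)
  then obtain m where "m < card reps" "\<not> 0 < bary x x' m"
    using mem_region_iff[OF x generic_in_flat[OF x']] by blast
  with bary_generic_nonzero[OF x x'] that show ?thesis
    by (metis linorder_neqE_linordered_idom)
qed

text \<open>Identifies the single pair that changes between neighbours with the pair belonging to
  the negative coordinate \<open>m\<close>, since the floors differ at the latter.\<close>

lemma adjacent_floors_bary:
  assumes x: "x \<in> generic" and x': "x' \<in> generic" and adj: "(cell x', cell x) \<in> adjacency"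
    and ij: "i \<in> reps" "j \<in> reps" "i \<noteq> j" "\<And>y. bary x y m = cdiff y i j - \<lfloor>cdiff x i j\<rfloor>"
    and neg: "bary x x' m < 0"
  shows "\<lfloor>cdiff x i j\<rfloor> = \<lfloor>cdiff x' i j\<rfloor> + 1"
    and "\<And>k l. k \<in> reps \<Longrightarrow> l \<in> reps \<Longrightarrow> k \<noteq> l \<Longrightarrow> {k, l} \<noteq> {i, j} \<Longrightarrow>
      \<lfloor>cdiff x k l\<rfloor> = \<lfloor>cdiff x' k l\<rfloor>"
proof -
  have less: "\<lfloor>cdiff x' i j\<rfloor> < \<lfloor>cdiff x i j\<rfloor>"
    using neg bary_neg_iff_floor[OF ij(4)] by blast
  have "(cell x' \<inter> cell x) facet_of cell x'" using adj by (auto simp: dual_graph_def)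
  then obtain i' j' where ij': "i' \<in> reps" "j' \<in> reps" "i' \<noteq> j'"
    "\<lfloor>cdiff x i' j'\<rfloor> = \<lfloor>cdiff x' i' j'\<rfloor> + 1"
    "\<And>k l. k \<in> reps \<Longrightarrow> l \<in> reps \<Longrightarrow> k \<noteq> l \<Longrightarrow> {k, l} \<noteq> {i', j'} \<Longrightarrow>
      \<lfloor>cdiff x' k l\<rfloor> = \<lfloor>cdiff x k l\<rfloor>"
    using adjacent_floors[OF x' x] by metis
  have eq: "{i, j} = {i', j'}"
    using ij'(5)[OF ij(1-3)] less by (metis less_irrefl)
  then consider "i = i'" "j = j'" | "i = j'" "j = i'"
    by (metis doubleton_eq_iff)
  then show "\<lfloor>cdiff x i j\<rfloor> = \<lfloor>cdiff x' i j\<rfloor> + 1"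
  proof cases
    case 1
    with ij'(4) show ?thesis by simp
  next
    case 2
    with ij'(4) less floor_cdiff_swap[OF x ij(1-3)] floor_cdiff_swap[OF x' ij(1-3)] show ?thesis
      by simp
  qed
  show "\<lfloor>cdiff x k l\<rfloor> = \<lfloor>cdiff x' k l\<rfloor>"
    if "k \<in> reps" "l \<in> reps" "k \<noteq> l" "{k, l} \<noteq> {i, j}" for k l
    using ij'(5)[of k l] that eq by simp
qed

text \<open>Across facet \<open>m\<close> all floors are forced: one pair drops by one, its reverse
  rises accordingly, and the rest stay.\<close>

lemma neighbour_unique:
  assumes x: "x \<in> generic" and "1 < card reps" and m: "m < card reps"
    and x': "x' \<in> generic" "(cell x', cell x) \<in> adjacency" "bary x x' m < 0"
    and x'': "x'' \<in> generic" "(cell x'', cell x) \<in> adjacency" "bary x x'' m < 0"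
  shows "cell x' = cell x''"
proof -
  obtain i j where ij: "i \<in> reps" "j \<in> reps" "i \<noteq> j" "\<And>y. bary x y m = cdiff y i j - \<lfloor>cdiff x i j\<rfloor>"
    using bary_facet[OF x assms(2) m] by blast
  note a' = adjacent_floors_bary[OF x x'(1,2) ij x'(3)]
  note a'' = adjacent_floors_bary[OF x x''(1,2) ij x''(3)]
  show ?thesis
  proof (rule cell_eq_if_reps[OF x'(1) x''(1)])
    fix k l assume kl: "k \<in> reps" "l \<in> reps" "k \<noteq> l"
    consider "k = i" "l = j" | "k = j" "l = i" | "{k, l} \<noteq> {i, j}"
      by (metis doubleton_eq_iff)
    then show "\<lfloor>cdiff x' k l\<rfloor> = \<lfloor>cdiff x'' k l\<rfloor>"
    proof cases
      case 1
      with a'(1) a''(1) show ?thesis by simp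
    next
      case 2
      with a'(1) a''(1) floor_cdiff_swap[OF x'(1) ij(1-3)] floor_cdiff_swap[OF x''(1) ij(1-3)]
      show ?thesis by simp
    next
      case 3
      with a'(2)[OF kl] a''(2)[OF kl] show ?thesis by simp
    qed
  qed
qed


section \<open>Separating hyperplanes and graph distance\<close>

text \<open>Every separating hyperplane is counted twice, once as \<open>(i, j)\<close> and once as \<open>(j, i)\<close>.\<close>

definition sep :: "real ^ 'n \<Rightarrow> real ^ 'n \<Rightarrow> nat" where
  "sep q x = (\<Sum>(i, j)\<in>reps \<times> reps. nat \<bar>\<lfloor>cdiff x i j\<rfloor> - \<lfloor>cdiff q i j\<rfloor>\<bar>)"

lemma sep_cong: "x \<in> generic \<Longrightarrow> y \<in> generic \<Longrightarrow> cell x = cell y \<Longrightarrow> sep q x = sep q y"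
  by (simp add: sep_def cell_eq_iff)

lemma sep_self: "sep q q = 0"
  by (simp add: sep_def)

text \<open>Only \<open>(i, j)\<close> and \<open>(j, i)\<close> contribute to the change, by one
  each and with equal sign; the sign depends on which side of the crossed hyperplane
  \<open>q\<close> lies.\<close>

lemma sep_change:
  assumes q: "q \<in> generic" and x: "x \<in> generic" and x': "x' \<in> generic"
    and ij: "i \<in> reps" "j \<in> reps" "i \<noteq> j" "\<lfloor>cdiff x i j\<rfloor> = \<lfloor>cdiff x' i j\<rfloor> + 1"
    and same: "\<And>k l. k \<in> reps \<Longrightarrow> l \<in> reps \<Longrightarrow> k \<noteq> l \<Longrightarrow> {k, l} \<noteq> {i, j} \<Longrightarrow>
      \<lfloor>cdiff x k l\<rfloor> = \<lfloor>cdiff x' k l\<rfloor>"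
  shows "if \<lfloor>cdiff q i j\<rfloor> < \<lfloor>cdiff x i j\<rfloor> then sep q x = sep q x' + 2 else sep q x' = sep q x + 2"
proof -
  define T where "T = (\<lambda>z (k, l). nat \<bar>\<lfloor>cdiff z k l\<rfloor> - \<lfloor>cdiff q k l\<rfloor>\<bar>)"
  let ?R = "reps \<times> reps - {(i, j), (j, i)}"
  have split: "sep q z = T z (i, j) + T z (j, i) + (\<Sum>p\<in>?R. T z p)" for z
  proof -
    have "sep q z = (\<Sum>p\<in>{(i, j), (j, i)}. T z p) + (\<Sum>p\<in>?R. T z p)"
      unfolding sep_def T_def[symmetric] using ij
      by (subst sum.subset_diff[of "{(i, j), (j, i)}"]) (auto simp: T_def)
    with ij(3) show ?thesis by simp
  qed
  have swap: "T z (j, i) = T z (i, j)" if "z \<in> generic" for z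
    using floor_cdiff_swap[OF that ij(1-3)] floor_cdiff_swap[OF q ij(1-3)]
    by (simp add: T_def)
  have "(\<Sum>p\<in>?R. T x p) = (\<Sum>p\<in>?R. T x' p)"
  proof (rule sum.cong)
    fix p assume "p \<in> ?R"
    then obtain k l where kl: "p = (k, l)" "k \<in> reps" "l \<in> reps" "(k, l) \<noteq> (i, j)" "(k, l) \<noteq> (j, i)"
      by auto
    show "T x p = T x' p"
    proof (cases "k = l")
      case True
      then show ?thesis by (simp add: T_def kl(1))
    next
      case False
      then have "{k, l} \<noteq> {i, j}" using kl by (auto simp: doubleton_eq_iff)
      then show ?thesis using same[OF kl(2,3) False] by (simp add: T_def kl(1))
    qed
  qed simp
  moreover have "if \<lfloor>cdiff q i j\<rfloor> < \<lfloor>cdiff x i j\<rfloor> then T x (i, j) = T x' (i, j) + 1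
      else T x' (i, j) = T x (i, j) + 1"
    using ij(4) by (auto simp: T_def)
  ultimately show ?thesis
    using split[of x] split[of x'] swap[OF x] swap[OF x'] by (auto split: if_splits)
qed

lemma sep_adjacent:
  assumes q: "q \<in> generic" and x: "x \<in> generic" and x': "x' \<in> generic"
    and adj: "(cell x', cell x) \<in> adjacency" and m: "m < card reps" "bary x x' m < 0"
  shows "if m \<in> visible q x then sep q x = sep q x' + 2 else sep q x' = sep q x + 2"
proof -
  have "1 < card reps"
    using card_reps_gt_1[OF x, of m x'] m by (simp add: visible_def)
  then obtain i j where ij: "i \<in> reps" "j \<in> reps" "i \<noteq> j"
    "\<And>y. bary x y m = cdiff y i j - \<lfloor>cdiff x i j\<rfloor>"
    using bary_facet[OF x _ m(1)] by blast
  have "m \<in> visible q x \<longleftrightarrow> \<lfloor>cdiff q i j\<rfloor> < \<lfloor>cdiff x i j\<rfloor>"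
    using m(1) bary_neg_iff_floor[OF ij(4), of q] by (simp add: visible_def)
  with sep_change[OF q x x' ij(1-3) adjacent_floors_bary[OF x x' adj ij m(2)]] show ?thesis
    by simp
qed

lemma ex_visible:
  assumes q: "q \<in> generic" and x: "x \<in> generic" and ne: "cell x \<noteq> cell q"
  obtains m where "m \<in> visible q x"
proof -
  have "q \<notin> region x"
    using ne cell_cong[of q x] by (auto simp: region_def)
  then obtain m where "m < card reps" "\<not> 0 < bary x q m"
    using mem_region_iff[OF x generic_in_flat[OF q]] by blast
  with bary_generic_nonzero[OF x q] have "m \<in> visible q x"
    by (auto simp: visible_def less_le not_less)
  then show ?thesis by (rule that)
qed

lemma visible_empty_iff:
  assumes "q \<in> generic" "x \<in> generic"
  shows "visible q x = {} \<longleftrightarrow> cell x = cell q"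
proof
  assume "visible q x = {}"
  then show "cell x = cell q" using ex_visible[OF assms] by blast
next
  assume "cell x = cell q"
  then have "q \<in> cell x" using mem_cell_self generic_in_P assms by blast
  then show "visible q x = {}"
    using mem_cell_iff[OF assms(2) generic_in_flat[OF assms(1)]] by (auto simp: visible_def not_less)
qed

text \<open>An edge changes \<open>sep\<close> by exactly 2 in one direction or the other, which
  bounds path lengths from below. Crossing visible facets repeatedly produces a path of that length,
  so the least length is actually attained.\<close>

lemma graph_dist_cell:
  assumes q: "q \<in> generic" and x: "x \<in> generic"
  shows "2 * graph_dist adjacency (cell q) (cell x) = sep q x"
proof -
  have lower: "sep q z \<le> 2 * k"
    if "(cell q, F) \<in> adjacency ^^ k" "z \<in> generic" "cell z = F" for k F z
    using that
  proof (induction k arbitrary: F z)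
    case 0
    then have "sep q z = sep q q" by (intro sep_cong) (auto simp: q)
    then show ?case by (simp add: sep_self)
  next
    case (Suc k)
    then obtain F' where F': "(cell q, F') \<in> adjacency ^^ k" "(F', cell z) \<in> adjacency"
      by auto
    then obtain z' where z': "z' \<in> generic" "F' = cell z'"
      by (auto simp: dual_graph_def)
    have adj: "(cell z', cell z) \<in> adjacency" using F'(2) z'(2) by simp
    obtain m where m: "m < card reps" "bary z z' m < 0"
      using adjacent_bary_neg[OF Suc.prems(2) z'(1) adj] by metis
    have "sep q z \<le> sep q z' + 2"
      using sep_adjacent[OF q Suc.prems(2) z'(1) adj m] by (auto split: if_splits)
    moreover have "sep q z' \<le> 2 * k"
      using Suc.IH[OF F'(1) z'(1)] z'(2) by simp
    ultimately show ?case by simp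
  qed
  have upper: "\<exists>k. (cell q, cell z) \<in> adjacency ^^ k \<and> 2 * k = sep q z" if "z \<in> generic" for z
    using that
  proof (induction "sep q z" arbitrary: z rule: less_induct)
    case less
    show ?case
    proof (cases "cell z = cell q")
      case True
      then have "sep q z = 0" using sep_cong[OF less.prems q] sep_self by metis
      with True show ?thesis by (intro exI[of _ 0]) simp
    next
      case False
      obtain m where m: "m \<in> visible q z" using ex_visible[OF q less.prems False] by blast
      obtain z' where z': "z' \<in> generic" "(cell z', cell z) \<in> adjacency" "bary z z' m < 0"
        using ex_neighbour[OF q less.prems m] by metis
      have s: "sep q z = sep q z' + 2"
        using sep_adjacent[OF q less.prems z'(1,2) _ z'(3)] m by (simp add: visible_def)
      then obtain k where "(cell q, cell z') \<in> adjacency ^^ k" "2 * k = sep q z'"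
        using less.hyps[of z'] z'(1) by auto
      with z'(2) s show ?thesis
        by (intro exI[of _ "Suc k"]) auto
    qed
  qed
  obtain k where k: "(cell q, cell x) \<in> adjacency ^^ k" "2 * k = sep q x"
    using upper[OF x] by blast
  have "graph_dist adjacency (cell q) (cell x) = k"
    unfolding graph_dist_def
  proof (rule Least_equality)
    show "(cell q, cell x) \<in> adjacency ^^ k" by (rule k(1))
    fix k' assume "(cell q, cell x) \<in> adjacency ^^ k'"
    then show "k \<le> k'" using lower[OF _ x] k(2) by fastforce
  qed
  with k(2) show ?thesis by simp
qed

text \<open>Sending a visible facet to the neighbour across it is a bijection onto the incoming
  arcs: an arc is incoming iff its tail has smaller \<open>sep\<close>, that is, iff the crossed
  facet is visible.\<close>

lemma card_incoming_arcs:
  assumes q: "q \<in> generic" and x: "x \<in> generic"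
  shows "card (incoming_arcs (orientation_away adjacency (cell q)) (cell x)) = card (visible q x)"
proof -
  have "\<forall>m\<in>visible q x. \<exists>x'. x' \<in> generic \<and> (cell x', cell x) \<in> adjacency \<and>
      bary x x' m < 0 \<and> (\<forall>k<card reps. k \<noteq> m \<longrightarrow> 0 < bary x x' k)"
    using ex_neighbour[OF q x] by metis
  then obtain nb where nb: "\<And>m. m \<in> visible q x \<Longrightarrow> nb m \<in> generic"
    "\<And>m. m \<in> visible q x \<Longrightarrow> (cell (nb m), cell x) \<in> adjacency"
    "\<And>m. m \<in> visible q x \<Longrightarrow> bary x (nb m) m < 0"
    "\<And>m k. m \<in> visible q x \<Longrightarrow> k < card reps \<Longrightarrow> k \<noteq> m \<Longrightarrow> 0 < bary x (nb m) k"
    by metis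
  have arc_iff: "(cell z, cell x) \<in> orientation_away adjacency (cell q) \<longleftrightarrow>
      (cell z, cell x) \<in> adjacency \<and> sep q x = sep q z + 2" if "z \<in> generic" for z
    using graph_dist_cell[OF q x] graph_dist_cell[OF q that] by (auto simp: orientation_away_def)
  have "incoming_arcs (orientation_away adjacency (cell q)) (cell x) =
      (\<lambda>m. (cell (nb m), cell x)) ` visible q x"
  proof (intro set_eqI iffI)
    fix a assume "a \<in> incoming_arcs (orientation_away adjacency (cell q)) (cell x)"
    then obtain F where F: "a = (F, cell x)" "(F, cell x) \<in> orientation_away adjacency (cell q)"
      by (cases a) (auto simp: incoming_arcs_def)
    then obtain z where z: "z \<in> generic" "F = cell z"
      by (auto simp: orientation_away_def dual_graph_def)
    have adj: "(cell z, cell x) \<in> adjacency" and s: "sep q x = sep q z + 2"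
      using F(2) z arc_iff by auto
    obtain m where m: "m < card reps" "bary x z m < 0"
      using adjacent_bary_neg[OF x z(1) adj] by blast
    have mv: "m \<in> visible q x"
      using sep_adjacent[OF q x z(1) adj m] s by (auto split: if_splits)
    have "cell z = cell (nb m)"
      by (rule neighbour_unique[OF x card_reps_gt_1[OF x mv] m(1) z(1) adj m(2) nb(1-3)[OF mv]])
    with F(1) z(2) mv show "a \<in> (\<lambda>m. (cell (nb m), cell x)) ` visible q x"
      by blast
  next
    fix a assume "a \<in> (\<lambda>m. (cell (nb m), cell x)) ` visible q x"
    then obtain m where m: "m \<in> visible q x" "a = (cell (nb m), cell x)" by blast
    have "sep q x = sep q (nb m) + 2"
      using sep_adjacent[OF q x nb(1,2)[OF m(1)] _ nb(3)[OF m(1)]] m(1) by (simp add: visible_def)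
    with arc_iff[OF nb(1)[OF m(1)]] nb(2)[OF m(1)] m(2)
    show "a \<in> incoming_arcs (orientation_away adjacency (cell q)) (cell x)"
      by (simp add: incoming_arcs_def)
  qed
  moreover have "inj_on (\<lambda>m. (cell (nb m), cell x)) (visible q x)"
  proof (rule inj_onI, rule ccontr)
    fix m m' assume m: "m \<in> visible q x" "m' \<in> visible q x"
      "(cell (nb m), cell x) = (cell (nb m'), cell x)" "m \<noteq> m'"
    have m': "m' < card reps" using m(2) by (simp add: visible_def)
    obtain i j where ij: "\<And>y. bary x y m' = cdiff y i j - \<lfloor>cdiff x i j\<rfloor>"
      using bary_facet[OF x card_reps_gt_1[OF x m(2)] m'] by blast
    \<comment> \<open>Equal cells have equal signs of coordinate \<open>m'\<close>, but this
      coordinate is negative at \<open>nb m'\<close> and positive at \<open>nb m\<close>.\<close>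
    have "\<lfloor>cdiff (nb m) i j\<rfloor> = \<lfloor>cdiff (nb m') i j\<rfloor>"
      using m(3) cell_eq_iff[OF nb(1)[OF m(1)] nb(1)[OF m(2)]] by blast
    with bary_neg_iff_floor[OF ij, of "nb m"] bary_neg_iff_floor[OF ij, of "nb m'"]
      nb(3)[OF m(2)] nb(4)[OF m(1) m'] m(4)
    show False by simp
  qed
  ultimately show ?thesis by (simp add: card_image)
qed

end

section \<open>Counting lattice points\<close>

text \<open>These are the barycentric coordinates, scaled by \<open>t\<close>, of the lattice points
  to be counted. Extensionality fixes the values outside \<open>S\<close>, so that each composition
  counts once.\<close>

definition comps :: "'a set \<Rightarrow> 'a set \<Rightarrow> nat \<Rightarrow> ('a \<Rightarrow> nat) set" where
  "comps S V t = {a \<in> S \<rightarrow>\<^sub>E UNIV. sum a S = t \<and> (\<forall>m\<in>V. 1 \<le> a m)}"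

lemma finite_comps:
  assumes "finite S"
  shows "finite (comps S V t)"
proof (rule finite_subset)
  show "comps S V t \<subseteq> S \<rightarrow>\<^sub>E {..t}"
  proof
    fix a assume a: "a \<in> comps S V t"
    then have "a m \<le> t" if "m \<in> S" for m
      using member_le_sum[OF that, of a] assms by (simp add: comps_def)
    with a show "a \<in> S \<rightarrow>\<^sub>E {..t}" by (auto simp: comps_def PiE_iff)
  qed
  show "finite (S \<rightarrow>\<^sub>E {..t})"
    using assms by (intro finite_PiE) auto
qed

text \<open>Fixing the value \<open>j\<close> at \<open>s\<close> gives a convolution; the weights
  are the coefficients of \<open>1 / (1 - z)\<close>, or of \<open>z / (1 - z)\<close> if a positive
  value is required.\<close>

lemma card_comps_insert:
  assumes S: "finite S" "s \<notin> S" and V: "V \<subseteq> insert s S"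
  shows "card (comps (insert s S) V t) =
    (\<Sum>j=0..t. (if s \<in> V \<and> j = 0 then 0 else 1) * card (comps S (V - {s}) (t - j)))"
proof -
  define J where "J = {j \<in> {0..t}. \<not> (s \<in> V \<and> j = 0)}"
  have "bij_betw (\<lambda>(j, b). b(s := j)) (SIGMA j:J. comps S (V - {s}) (t - j)) (comps (insert s S) V t)"
  proof (rule bij_betw_byWitness[where f' = "\<lambda>a. (a s, restrict a S)"])
    show "\<forall>p\<in>SIGMA j:J. comps S (V - {s}) (t - j).
        (\<lambda>a. (a s, restrict a S)) ((\<lambda>(j, b). b(s := j)) p) = p"
      using S by (auto simp: comps_def PiE_iff extensional_def restrict_def fun_eq_iff)
    show "\<forall>a\<in>comps (insert s S) V t. (\<lambda>(j, b). b(s := j)) (a s, restrict a S) = a"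
      by (auto simp: comps_def PiE_iff extensional_def restrict_def fun_eq_iff)
    show "(\<lambda>(j, b). b(s := j)) ` (SIGMA j:J. comps S (V - {s}) (t - j)) \<subseteq> comps (insert s S) V t"
    proof clarify
      fix j b assume jb: "j \<in> J" "b \<in> comps S (V - {s}) (t - j)"
      have "sum (b(s := j)) S = sum b S"
        using S by (intro sum.cong) auto
      with jb S V show "b(s := j) \<in> comps (insert s S) V t"
        by (auto simp: comps_def J_def PiE_iff extensional_def)
    qed
    show "(\<lambda>a. (a s, restrict a S)) ` comps (insert s S) V t \<subseteq> (SIGMA j:J. comps S (V - {s}) (t - j))"
      using S V by (fastforce simp: comps_def J_def)
  qed
  then have "card (comps (insert s S) V t) = card (SIGMA j:J. comps S (V - {s}) (t - j))"
    by (simp add: bij_betw_same_card)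
  also have "\<dots> = (\<Sum>j\<in>J. card (comps S (V - {s}) (t - j)))"
    using S by (intro card_SigmaI) (auto simp: J_def finite_comps)
  also have "\<dots> = (\<Sum>j=0..t. (if s \<in> V \<and> j = 0 then 0 else 1) * card (comps S (V - {s}) (t - j)))"
    unfolding J_def by (subst sum.inter_filter) (auto intro!: sum.cong)
  finally show ?thesis .
qed

lemma comps_fps:
  fixes S V :: "'a set"
  assumes "finite S" "V \<subseteq> S"
  shows "Abs_fps (\<lambda>t. int (card (comps S V t))) * (1 - fps_X) ^ card S = fps_X ^ card V"
  using assms
proof (induction S arbitrary: V rule: finite_induct)
  case empty
  have "comps ({} :: 'a set) {} t = (if t = 0 then {\<lambda>_. undefined} else {})" for t :: nat
    by (auto simp: comps_def)
  then have "Abs_fps (\<lambda>t. int (card (comps ({} :: 'a set) {} t))) = (1 :: int fps)"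
    by (intro fps_ext) simp
  with empty show ?case by simp
next
  case (insert s S)
  define G :: "int fps" where "G = Abs_fps (\<lambda>j. if s \<in> V \<and> j = 0 then 0 else 1)"
  define A :: "int fps" where "A = Abs_fps (\<lambda>t. int (card (comps S (V - {s}) t)))"
  have "Abs_fps (\<lambda>t. int (card (comps (insert s S) V t))) = G * A"
    using insert.hyps insert.prems
    by (intro fps_ext) (auto simp: card_comps_insert fps_mult_nth G_def A_def intro!: sum.cong)
  moreover have "G * (1 - fps_X) = (if s \<in> V then fps_X else 1)"
  proof (intro fps_ext)
    fix n
    show "fps_nth (G * (1 - fps_X)) n = fps_nth (if s \<in> V then fps_X else 1) n"
      by (cases n) (auto simp: G_def right_diff_distrib)
  qed
  moreover have "A * (1 - fps_X) ^ card S = fps_X ^ card (V - {s})"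
    unfolding A_def using insert.prems by (intro insert.IH) auto
  moreover have "G * A * (1 - fps_X) ^ card (insert s S) =
      (G * (1 - fps_X)) * (A * (1 - fps_X) ^ card S)"
    using insert.hyps by simp
  ultimately have "Abs_fps (\<lambda>t. int (card (comps (insert s S) V t))) * (1 - fps_X) ^ card (insert s S)
      = (if s \<in> V then fps_X else 1) * fps_X ^ card (V - {s})"
    by simp
  also have "\<dots> = fps_X ^ card V"
  proof (cases "s \<in> V")
    case True
    have "finite V" using insert.prems insert.hyps finite_subset by auto
    with True have "card V = Suc (card (V - {s}))" by (metis card.remove)
    with True show ?thesis by (simp only: if_True power_Suc)
  qed simp
  finally show ?case .
qed

lemma card_comps_0:
  assumes "finite S" "V \<subseteq> S"
  shows "card (comps S V 0) = (if V = {} then 1 else 0)"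
proof -
  have "finite V" using assms finite_subset by blast
  have "fps_nth (Abs_fps (\<lambda>t. int (card (comps S V t))) * (1 - fps_X) ^ card S) 0 = int (card (comps S V 0))"
    by (simp add: fps_power_zeroth)
  then have "int (card (comps S V 0)) = fps_nth (fps_X ^ card V) 0"
    using comps_fps[OF assms] by simp
  with \<open>finite V\<close> show ?thesis
    by (auto simp: fps_X_power_nth split: if_splits)
qed

context alcoved_body
begin

section \<open>Lattice points of half-open simplices\<close>

definition half_open :: "real ^ 'n \<Rightarrow> real ^ 'n \<Rightarrow> (real ^ 'n) set" where
  "half_open q x = {y \<in> P. \<forall>\<^sub>F e in at_right 0. y + e *\<^sub>R (q - y) \<in> region x}"

text \<open>Instead of dilating \<open>P\<close>, the lattice is refined by the factor
  \<open>t\<close>. At \<open>t = 0\<close> this would be the whole space, so that case is treated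
  apart.\<close>

definition fractional :: "nat \<Rightarrow> (real ^ 'n) set" where
  "fractional t = {y. \<forall>i. real t * y $ i \<in> \<int>}"

lemma fractional_ext_coord: "y \<in> fractional t \<Longrightarrow> real t * ext_coord y i \<in> \<int>"
  by (cases i) (auto simp: fractional_def)

lemma mem_half_open_iff:
  assumes q: "q \<in> generic" and x: "x \<in> generic" and y: "y \<in> flat"
  shows "y \<in> half_open q x \<longleftrightarrow>
    (\<forall>m<card reps. 0 \<le> bary x y m) \<and> (\<forall>m\<in>visible q x. 0 < bary x y m)"
  unfolding half_open_def mem_Collect_eq eventually_region_iff[OF q x y]
  using mem_cell_iff[OF x y] cell_subset by blast

lemma fractional_bary:
  assumes "y \<in> fractional t"
  shows "real t * bary x y m \<in> \<int>"
proof -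
  have "real t * lev x y k \<in> \<int>" for k
  proof (cases "k < card reps")
    case True
    then show ?thesis
      using fractional_ext_coord[OF assms] by (auto simp: lev_def right_diff_distrib)
  qed (simp add: lev_def)
  then show ?thesis by (simp add: bary_def right_diff_distrib)
qed

text \<open>Scaling barycentric coordinates by \<open>t\<close> turns lattice points into
  compositions of \<open>t\<close>; the removed facets demand positive parts. Surjectivity is
  unimodularity.\<close>

lemma fractional_half_open:
  assumes q: "q \<in> generic" and x: "x \<in> generic" and t: "0 < t"
  shows "finite (fractional t \<inter> half_open q x)"
    and "card (fractional t \<inter> half_open q x) = card (comps {..<card reps} (visible q x) t)"
proof -
  \<comment> \<open>The floor and \<open>nat\<close> only convert types: on the points considered
    the scaled coordinates are nonnegative integers.\<close>
  define \<phi> where "\<phi> = (\<lambda>y. \<lambda>m\<in>{..<card reps}. nat \<lfloor>real t * bary x y m\<rfloor>)"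
  have half_flat: "half_open q x \<subseteq> flat"
    using P_subset_flat by (auto simp: half_open_def)
  have \<phi>: "real (\<phi> y m) = real t * bary x y m"
    if y: "y \<in> fractional t \<inter> half_open q x" and m: "m < card reps" for y m
  proof -
    have "0 \<le> bary x y m"
      using y m half_flat mem_half_open_iff[OF q x, of y] by blast
    then have "0 \<le> real t * bary x y m" by simp
    moreover have "real t * bary x y m \<in> \<int>"
      using y by (intro fractional_bary) auto
    ultimately show ?thesis
      using m by (auto simp: \<phi>_def elim!: Ints_cases)
  qed
  have "bij_betw \<phi> (fractional t \<inter> half_open q x) (comps {..<card reps} (visible q x) t)"
  proof (rule bij_betw_imageI)
    show "inj_on \<phi> (fractional t \<inter> half_open q x)"
    proof (rule inj_onI)
      fix y z assume y: "y \<in> fractional t \<inter> half_open q x" and z: "z \<in> fractional t \<inter> half_open q x"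
        and eq: "\<phi> y = \<phi> z"
      show "y = z"
      proof (rule bary_inject[OF x])
        show "y \<in> flat" "z \<in> flat" using y z half_flat by auto
        show "bary x y m = bary x z m" if "m < card reps" for m
          using \<phi>[OF y that] \<phi>[OF z that] eq t by simp
      qed
    qed
    show "\<phi> ` (fractional t \<inter> half_open q x) = comps {..<card reps} (visible q x) t"
    proof (intro set_eqI iffI)
      fix a assume "a \<in> \<phi> ` (fractional t \<inter> half_open q x)"
      then obtain y where y: "y \<in> fractional t \<inter> half_open q x" "a = \<phi> y" by blast
      have "real (sum a {..<card reps}) = (\<Sum>m<card reps. real t * bary x y m)"
        unfolding of_nat_sum y(2) by (rule sum.cong) (use \<phi>[OF y(1)] in auto)
      also have "\<dots> = real t"
        by (simp add: sum_bary[OF x] flip: sum_distrib_left)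
      finally have "sum a {..<card reps} = t" by (simp only: of_nat_eq_iff)
      moreover have "1 \<le> a m" if m: "m \<in> visible q x" for m
      proof -
        have "m < card reps" using m by (simp add: visible_def)
        moreover have "0 < bary x y m"
          using y(1) m half_flat mem_half_open_iff[OF q x, of y] by blast
        ultimately have "0 < real (a m)"
          using \<phi>[OF y(1)] y(2) t by simp
        then show ?thesis by simp
      qed
      moreover have "a \<in> {..<card reps} \<rightarrow>\<^sub>E UNIV"
        by (simp add: y(2) \<phi>_def)
      ultimately show "a \<in> comps {..<card reps} (visible q x) t"
        by (simp add: comps_def)
    next
      fix a assume a: "a \<in> comps {..<card reps} (visible q x) t"
      have "(\<Sum>m<card reps. real (a m) / real t) = real (sum a {..<card reps}) / real t"
        by (simp add: sum_divide_distrib)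
      also have "\<dots> = 1" using a t by (simp add: comps_def)
      finally have w: "(\<Sum>m<card reps. real (a m) / real t) = 1" .
      obtain y where y: "y \<in> flat" "\<And>m. m < card reps \<Longrightarrow> bary x y m = real (a m) / real t"
        "\<And>m. m \<le> card reps \<Longrightarrow> lev x y m = (\<Sum>k<m. real (a k) / real t)"
        using ex_bary[OF x w] by metis
      have "\<forall>m\<in>visible q x. 1 \<le> a m" using a by (simp add: comps_def)
      then have "y \<in> half_open q x"
        unfolding mem_half_open_iff[OF q x y(1)]
        using t by (fastforce simp: y(2) visible_def)
      moreover have "y \<in> fractional t"
      proof -
        have reps: "real t * ext_coord y i \<in> \<int>" if i: "i \<in> reps" for i
        proof -
          obtain k where k: "k < card reps" "i = enum x k"
            using ex_enum_index[OF x i] by metis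
          \<comment> \<open>The coordinate is an integer plus a partial sum of weights
            \<open>a m / t\<close>, so \<open>t\<close> clears its denominator.\<close>
          have "ext_coord y i = lev x y k + \<lfloor>ext_coord x i\<rfloor>"
            using k by (simp add: lev_def)
          also have "lev x y k = real (\<Sum>m<k. a m) / real t"
            using y(3)[of k] k by (simp add: sum_divide_distrib)
          finally have "real t * ext_coord y i = real (\<Sum>m<k. a m) + real t * \<lfloor>ext_coord x i\<rfloor>"
            using t by (simp add: field_simps)
          then show ?thesis by (metis Ints_add Ints_mult Ints_of_int Ints_of_nat)
        qed
        have "real t * y $ m \<in> \<int>" for m
        proof -
          obtain c :: int where
            "\<And>y. y \<in> flat \<Longrightarrow> cdiff y (Some m) None = cdiff y (rep (Some m)) (rep None) + c"
            using flat_cdiff_rep[OF generic_in_P[OF x]] by blast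
          from this[OF y(1)] have "real t * y $ m = real t * ext_coord y (rep (Some m)) + real t * c"
            by (simp add: distrib_left)
          with reps[OF rep_in_reps] show ?thesis
            by (metis Ints_add Ints_mult Ints_of_int Ints_of_nat)
        qed
        then show ?thesis by (simp add: fractional_def)
      qed
      ultimately have yy: "y \<in> fractional t \<inter> half_open q x" by blast
      have "\<phi> y m = a m" for m
      proof (cases "m < card reps")
        case True
        with \<phi>[OF yy True] y(2)[OF True] t show ?thesis by simp
      next
        case False
        with a show ?thesis by (auto simp: \<phi>_def comps_def PiE_iff extensional_def)
      qed
      then have "a = \<phi> y" by auto
      with yy show "a \<in> \<phi> ` (fractional t \<inter> half_open q x)" by blast
    qed
  qed
  then show "finite (fractional t \<inter> half_open q x)"
    "card (fractional t \<inter> half_open q x) = card (comps {..<card reps} (visible q x) t)"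
    using bij_betw_finite finite_comps[OF finite_lessThan] bij_betw_same_card by metis+
qed

lemma region_cong: "x \<in> generic \<Longrightarrow> y \<in> generic \<Longrightarrow> cell x = cell y \<Longrightarrow> region x = region y"
  by (simp add: region_eq generic_in_P)

text \<open>For \<open>t > 0\<close> this is the partition of \<open>P\<close> into half-open
  simplices: every point moves into some region, and never into two.\<close>

lemma ehrhart_count_eq:
  assumes q: "q \<in> generic"
  shows "ehrhart_count P t =
    (\<Sum>F\<in>cell ` generic. card (comps {..<card reps} (visible q (inv_into generic cell F)) t))"
proof -
  let ?pick = "inv_into generic cell"
  have pick: "?pick F \<in> generic" "cell (?pick F) = F" if "F \<in> cell ` generic" for F
    using inv_into_into[OF that] f_inv_into_f[OF that] by auto
  show ?thesis
  proof (cases "t = 0")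
    case True
    have "P \<noteq> {}" using q generic_in_P by blast
    then have "(\<lambda>x. real t *\<^sub>R x) ` P \<inter> {x. \<forall>i. x $ i \<in> \<int>} = {0}"
      using True by auto
    then have "ehrhart_count P t = 1" by (simp add: ehrhart_count_def)
    \<comment> \<open>The zero dilate of \<open>P\<close> contributes one point, matched by the only
      simplex from which no facet is removed, the one around \<open>q\<close>.\<close>
    moreover have "card (comps {..<card reps} (visible q (?pick F)) t) = (if F = cell q then 1 else 0)"
      if F: "F \<in> cell ` generic" for F
    proof -
      have "visible q (?pick F) \<subseteq> {..<card reps}" by (auto simp: visible_def)
      then show ?thesis
        using True visible_empty_iff[OF q pick(1)[OF F]] pick(2)[OF F] by (simp add: card_comps_0)
    qed
    ultimately show ?thesis
      using q finite_cells by (simp cong: sum.cong)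
  next
    case False
    then have t: "0 < t" by simp
    have "(\<lambda>x. real t *\<^sub>R x) ` P \<inter> {x. \<forall>i. x $ i \<in> \<int>} = (\<lambda>x. real t *\<^sub>R x) ` (fractional t \<inter> P)"
      by (auto simp: fractional_def)
    then have "ehrhart_count P t = card (fractional t \<inter> P)"
      using t by (simp add: ehrhart_count_def card_image inj_on_def)
    also have "fractional t \<inter> P = (\<Union>F\<in>cell ` generic. fractional t \<inter> half_open q (?pick F))"
    proof (intro set_eqI iffI)
      fix y assume y: "y \<in> fractional t \<inter> P"
      then obtain x where x: "x \<in> generic" "\<forall>\<^sub>F e in at_right 0. y + e *\<^sub>R (q - y) \<in> region x"
        using ex_region_toward[OF q, of y] by blast
      have "region (?pick (cell x)) = region x"
        using x(1) pick[of "cell x"] by (intro region_cong) auto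
      with x y have "y \<in> half_open q (?pick (cell x))" by (simp add: half_open_def)
      with x(1) y show "y \<in> (\<Union>F\<in>cell ` generic. fractional t \<inter> half_open q (?pick F))"
        by blast
    next
      fix y assume "y \<in> (\<Union>F\<in>cell ` generic. fractional t \<inter> half_open q (?pick F))"
      then show "y \<in> fractional t \<inter> P" by (auto simp: half_open_def)
    qed
    also have "card \<dots> = (\<Sum>F\<in>cell ` generic. card (fractional t \<inter> half_open q (?pick F)))"
    proof (rule card_UN_disjoint[OF finite_cells])
      show "\<forall>F\<in>cell ` generic. finite (fractional t \<inter> half_open q (?pick F))"
        using fractional_half_open(1)[OF q pick(1) t] by blast
      show "\<forall>F\<in>cell ` generic. \<forall>F'\<in>cell ` generic. F \<noteq> F' \<longrightarrow>
          fractional t \<inter> half_open q (?pick F) \<inter> (fractional t \<inter> half_open q (?pick F')) = {}"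
      proof (intro ballI impI, rule ccontr)
        fix F F' assume F: "F \<in> cell ` generic" and F': "F' \<in> cell ` generic" and ne: "F \<noteq> F'"
          and "fractional t \<inter> half_open q (?pick F) \<inter> (fractional t \<inter> half_open q (?pick F')) \<noteq> {}"
        then obtain y where "\<forall>\<^sub>F e in at_right 0. y + e *\<^sub>R (q - y) \<in> region (?pick F)"
          "\<forall>\<^sub>F e in at_right 0. y + e *\<^sub>R (q - y) \<in> region (?pick F')"
          by (auto simp: half_open_def)
        then have "\<forall>\<^sub>F e in at_right 0. y + e *\<^sub>R (q - y) \<in> region (?pick F) \<inter> region (?pick F')"
          by eventually_elim blast
        then obtain z where "z \<in> region (?pick F)" "z \<in> region (?pick F')"
          using eventually_happens'[OF trivial_limit_at_right_real] by blast
        then have "cell (?pick F) = cell (?pick F')"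
          by (intro cell_cong) (simp add: region_def)
        with ne pick(2)[OF F] pick(2)[OF F'] show False by simp
      qed
    qed
    also have "\<dots> = (\<Sum>F\<in>cell ` generic. card (comps {..<card reps} (visible q (?pick F)) t))"
      by (intro sum.cong refl fractional_half_open(2)[OF q pick(1) t])
    finally show ?thesis .
  qed
qed

lemma h_star_eq:
  assumes q: "q \<in> generic"
  shows "h_star P k = int (card {F \<in> cell ` generic.
    card (incoming_arcs (orientation_away adjacency (cell q)) F) = k})"
proof -
  let ?pick = "inv_into generic cell"
  define v where "v = (\<lambda>F. visible q (?pick F))"
  \<comment> \<open>The exponent of the Ehrhart denominator is the number of vertices of each
    simplex, so one factor clears all summands.\<close>
  have dim: "nat (aff_dim P) + 1 = card reps"
  proof -
    have "aff_dim P = int (card reps) - 1" using q by (intro aff_dim_P) blast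
    with card_reps_pos show ?thesis by linarith
  qed
  have in_v: "card (incoming_arcs (orientation_away adjacency (cell q)) F) = card (v F)"
    if F: "F \<in> cell ` generic" for F
  proof -
    have "?pick F \<in> generic" "cell (?pick F) = F"
      using inv_into_into[OF F] f_inv_into_f[OF F] by auto
    then show ?thesis using card_incoming_arcs[OF q, of "?pick F"] by (simp add: v_def)
  qed
  have "ehrhart_series P = (\<Sum>F\<in>cell ` generic. Abs_fps (\<lambda>t. int (card (comps {..<card reps} (v F) t))))"
    by (rule fps_ext) (simp add: ehrhart_series_def ehrhart_count_eq[OF q] fps_sum_nth v_def)
  then have "ehrhart_series P * (1 - fps_X) ^ card reps =
      (\<Sum>F\<in>cell ` generic. Abs_fps (\<lambda>t. int (card (comps {..<card reps} (v F) t))) *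
        (1 - fps_X) ^ card {..<card reps})"
    by (simp add: sum_distrib_right)
  also have "\<dots> = (\<Sum>F\<in>cell ` generic. fps_X ^ card (v F))"
    by (intro sum.cong refl comps_fps) (auto simp: v_def visible_def)
  finally have "h_star P k = (\<Sum>F\<in>cell ` generic. if card (v F) = k then 1 else 0)"
    unfolding h_star_def dim
    by (simp add: fps_sum_nth fps_X_power_nth eq_commute cong: if_cong)
  also have "\<dots> = int (card {F \<in> cell ` generic. card (v F) = k})"
    using finite_cells by (simp add: sum.If_cases Int_def)
  also have "{F \<in> cell ` generic. card (v F) = k} = {F \<in> cell ` generic.
      card (incoming_arcs (orientation_away adjacency (cell q)) F) = k}"
    using in_v by (intro Collect_cong) (metis (no_types, lifting))
  finally show ?thesis .
qed

end

theorem theorem2p6: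
  fixes P F\<^sub>0 :: "(real ^ 'n) set" and k :: nat
  assumes "alcoved P"
    and "F\<^sub>0 \<in> alcoved_triangulation P"
  shows "h_star P k =
    int (card {F \<in> alcoved_triangulation P.
      card (incoming_arcs (orientation_away (dual_graph (alcoved_triangulation P)) F\<^sub>0) F) = k})"
proof -
  interpret alcoved_body P
  proof
    show "bounded P"
      using assms(1) polytope_imp_bounded by (auto simp: alcoved_def)
  qed (rule alcoved_halfspaces[OF assms(1)], blast)
  obtain q where "q \<in> generic" "F\<^sub>0 = cell q"
    using assms(2) by (auto simp: alcoved_triangulation_eq)
  then show ?thesis
    by (simp add: h_star_eq alcoved_triangulation_eq)
qed

end
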